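(* Let $n\ge 0$ be an integer. The space $\mathbf{rat}_n(1)$ consists of $n+1$ contractible connected components. These components are indexed by the topological degree of the map $\mathbf{RP}^1\to\mathbf{RP}^1$, which ranges over the integers from $-n$ to $n$ having the same parity as $n$.
   Context: $\Omega\mathbf{RP}^m$ denotes the space of continuous basepoint-preserving maps $\mathbf{RP}^1\to\mathbf{RP}^m$ (sending $\infty\in\mathbf{RP}^1=\mathbf{R}\cup\{\infty\}$ to the basepoint $[1:1:\cdots:1]$), with the compact-open topology. $\mathrm{RRat}_n(m)$ denotes the space of basepoint-preserving rational maps $\mathbf{CP}^1\to\mathbf{CP}^m$ of degree $n$ (sending $\infty$ to $[1:\cdots:1]$) that commute with complex conjugation. Equivalently, its elements are the maps $x\mapsto[f_0(x):\cdots:f_m(x)]$ where $f_0,\dots,f_m$ are monic polynomials of degree $n$ with real coefficients having no common zero in $\mathbf{C}$. Such a map is uniquely determined by its restriction to the real axis $\mathbf{RP}^1\to\mathbf{RP}^m$, so restriction gives an inclusion of sets $\mathrm{RRat}_n(m)\subset\Omega\mathbf{RP}^m$. The space $\mathbf{rat}_n(m)$ is defined as the closure of (the image of) $\mathrm{RRat}_n(m)$ in $\Omega\mathbf{RP}^m$, with the subspace topology. Here $m=1$. *)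

theory Defs
  imports
    "HOL-Homology.Brouwer_Degree"
    "HOL-Computational_Algebra.Polynomial"
begin

definition quotient_topology :: "'a topology \<Rightarrow> ('a \<Rightarrow> 'b) \<Rightarrow> 'b topology" where
  "quotient_topology X q = topology
     (\<lambda>U. U \<subseteq> q ` topspace X \<and> openin X {x \<in> topspace X. q x \<in> U})"

lemma openin_quotient_topology:
  "openin (quotient_topology X q) U \<longleftrightarrow>
     U \<subseteq> q ` topspace X \<and> openin X {x \<in> topspace X. q x \<in> U}"
proof -
  have "istopology (\<lambda>U. U \<subseteq> q ` topspace X \<and> openin X {x \<in> topspace X. q x \<in> U})"
    unfolding istopology_def
  proof (intro conjI allI impI)
    fix S T
    assume S: "S \<subseteq> q ` topspace X \<and> openin X {x \<in> topspace X. q x \<in> S}"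
      and T: "T \<subseteq> q ` topspace X \<and> openin X {x \<in> topspace X. q x \<in> T}"
    from S show "S \<inter> T \<subseteq> q ` topspace X" by blast
    have "{x \<in> topspace X. q x \<in> S \<inter> T}
        = {x \<in> topspace X. q x \<in> S} \<inter> {x \<in> topspace X. q x \<in> T}" by blast
    then show "openin X {x \<in> topspace X. q x \<in> S \<inter> T}"
      using S T by (simp add: openin_Int)
  next
    fix \<K>
    assume *: "\<forall>K\<in>\<K>. K \<subseteq> q ` topspace X \<and> openin X {x \<in> topspace X. q x \<in> K}"
    then show "\<Union>\<K> \<subseteq> q ` topspace X" by blast
    have "{x \<in> topspace X. q x \<in> \<Union>\<K>} = \<Union>((\<lambda>K. {x \<in> topspace X. q x \<in> K}) ` \<K>)"
      by blast
    moreover have "openin X (\<Union>((\<lambda>K. {x \<in> topspace X. q x \<in> K}) ` \<K>))"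
      by (rule openin_Union) (use * in auto)
    ultimately show "openin X {x \<in> topspace X. q x \<in> \<Union>\<K>}" by simp
  qed
  then show ?thesis
    unfolding quotient_topology_def by (simp only: topology_inverse')
qed

lemma topspace_quotient_topology [simp]: "topspace (quotient_topology X q) = q ` topspace X"
proof
  have "openin (quotient_topology X q) (topspace (quotient_topology X q))"
    by (rule openin_topspace)
  then show "topspace (quotient_topology X q) \<subseteq> q ` topspace X"
    unfolding openin_quotient_topology by (rule conjunct1)
  have "{x \<in> topspace X. q x \<in> q ` topspace X} = topspace X" by auto
  then have "openin (quotient_topology X q) (q ` topspace X)"
    by (simp add: openin_quotient_topology)
  then show "q ` topspace X \<subseteq> topspace (quotient_topology X q)"
    by (rule openin_subset)
qed

lemma quotient_map_quotient_topology: "quotient_map X (quotient_topology X q) q"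
  by (auto simp: quotient_map_def openin_quotient_topology)

text \<open>Points of real projective space are the classes of non-zero vectors under non-zero scaling;
  vectors of length \<open>m + 1\<close> are represented as in \<^const>\<open>Euclidean_space\<close>, that is, as functions
  vanishing at the indices above \<open>m\<close>.\<close>

definition proj_class :: "(nat \<Rightarrow> real) \<Rightarrow> (nat \<Rightarrow> real) set" where
  "proj_class v = {\<lambda>i. c * v i | c. c \<noteq> 0}"

definition RP :: "nat \<Rightarrow> (nat \<Rightarrow> real) set topology" where
  "RP m = quotient_topology
     (subtopology (Euclidean_space (Suc m)) (- {\<lambda>i. 0})) proj_class"

text \<open>The point \<open>[v 0 : \<dots> : v m]\<close>.\<close>

definition homog :: "nat \<Rightarrow> (nat \<Rightarrow> real) \<Rightarrow> (nat \<Rightarrow> real) set" where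
  "homog m v = proj_class (\<lambda>i. if i \<le> m then v i else 0)"

definition base_pt :: "nat \<Rightarrow> (nat \<Rightarrow> real) set" where
  "base_pt m = homog m (\<lambda>i. 1)"

text \<open>The identification of the projective line with the real line together with a point at
  infinity: \<open>x\<close> is \<open>[x : 1]\<close> and infinity is \<open>[1 : 0]\<close>.\<close>

definition RP1_affine :: "real \<Rightarrow> (nat \<Rightarrow> real) set" where
  "RP1_affine x = homog 1 (\<lambda>i. if i = 0 then x else 1)"

definition RP1_infinity :: "(nat \<Rightarrow> real) set" where
  "RP1_infinity = homog 1 (\<lambda>i. if i = 0 then 1 else 0)"

text \<open>Maps between spaces are made extensional, so that they are determined by their values on
  the carrier.\<close>

definition continuous_maps :: "'a topology \<Rightarrow> 'b topology \<Rightarrow> ('a \<Rightarrow> 'b) set" where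
  "continuous_maps X Y = {f \<in> extensional (topspace X). continuous_map X Y f}"

definition compact_open_topology :: "'a topology \<Rightarrow> 'b topology \<Rightarrow> ('a \<Rightarrow> 'b) topology" where
  "compact_open_topology X Y = topology_generated_by
     {{f \<in> continuous_maps X Y. f ` K \<subseteq> U} | K U. compactin X K \<and> openin Y U}"

lemma topspace_compact_open_topology [simp]:
  "topspace (compact_open_topology X Y) = continuous_maps X Y"
proof -
  have "continuous_maps X Y = {f \<in> continuous_maps X Y. f ` {} \<subseteq> {}}" by simp
  moreover have "compactin X {}" "openin Y {}" by auto
  ultimately have "continuous_maps X Y \<in>
      {{f \<in> continuous_maps X Y. f ` K \<subseteq> U} | K U. compactin X K \<and> openin Y U}"
    by blast
  then have "continuous_maps X Y \<subseteq>
      \<Union>{{f \<in> continuous_maps X Y. f ` K \<subseteq> U} | K U. compactin X K \<and> openin Y U}"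
    by (rule Union_upper)
  moreover have "\<Union>{{f \<in> continuous_maps X Y. f ` K \<subseteq> U} | K U. compactin X K \<and> openin Y U}
      \<subseteq> continuous_maps X Y"
    by blast
  ultimately show ?thesis
    unfolding compact_open_topology_def topology_generated_by_topspace by (rule equalityI[rotated])
qed

definition loop_RP :: "nat \<Rightarrow> ((nat \<Rightarrow> real) set \<Rightarrow> (nat \<Rightarrow> real) set) topology" where
  "loop_RP m = subtopology (compact_open_topology (RP 1) (RP m)) {f. f RP1_infinity = base_pt m}"

text \<open>The restrictions to the real axis of the real based rational maps of degree \<open>n\<close>.\<close>

definition RRat :: "nat \<Rightarrow> nat \<Rightarrow> ((nat \<Rightarrow> real) set \<Rightarrow> (nat \<Rightarrow> real) set) set" where
  "RRat n m = {f \<in> extensional (topspace (RP 1)). \<exists>p :: nat \<Rightarrow> real poly.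
     (\<forall>i\<le>m. degree (p i) = n \<and> lead_coeff (p i) = 1) \<and>
     \<not> (\<exists>z::complex. \<forall>i\<le>m. poly (map_poly complex_of_real (p i)) z = 0) \<and>
     f RP1_infinity = base_pt m \<and>
     (\<forall>x. f (RP1_affine x) = homog m (\<lambda>i. poly (p i) x))}"

definition rat_space :: "nat \<Rightarrow> nat \<Rightarrow> ((nat \<Rightarrow> real) set \<Rightarrow> (nat \<Rightarrow> real) set) topology" where
  "rat_space n m = subtopology (loop_RP m) (Abstract_Topology.closure_of (loop_RP m) (RRat n m))"

text \<open>The homeomorphism from the projective line to the unit circle that doubles angles,
  \<open>[cos t : sin t] \<mapsto> (cos 2t, sin 2t)\<close>. It is constant on each class, so the image of a class
  is a singleton.\<close>

definition double_angle :: "(nat \<Rightarrow> real) \<Rightarrow> nat \<Rightarrow> real" where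
  "double_angle v = (\<lambda>i.
     if i = 0 then ((v 0)\<^sup>2 - (v 1)\<^sup>2) / ((v 0)\<^sup>2 + (v 1)\<^sup>2)
     else if i = 1 then 2 * v 0 * v 1 / ((v 0)\<^sup>2 + (v 1)\<^sup>2)
     else 0)"

definition RP1_to_circle :: "(nat \<Rightarrow> real) set \<Rightarrow> nat \<Rightarrow> real" where
  "RP1_to_circle L = the_elem (double_angle ` L)"

text \<open>The topological degree of a self-map of the projective line. The same identification with
  the circle is used on both sides, so the degree does not depend on its choice.\<close>

definition RP1_degree :: "((nat \<Rightarrow> real) set \<Rightarrow> (nat \<Rightarrow> real) set) \<Rightarrow> int" where
  "RP1_degree f = Brouwer_degree2 1
     (RP1_to_circle \<circ> f \<circ> inv_into (topspace (RP 1)) RP1_to_circle)"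

end

theory Submission
  imports Defs "HOL-Complex_Analysis.Complex_Analysis"
    "HOL-Computational_Algebra.Fundamental_Theorem_Algebra"
begin

text \<open>In affine coordinates a based rational map \<open>[P : Q]\<close> is a monic complex polynomial
  \<open>F = (P + \<i>Q) / (1 + \<i>)\<close> without real roots, read as a map from the real line to the
  non-zero complex numbers modulo real scalars; pairs of conjugate roots may be cancelled. A limit of
  such maps is again of this form, because the normalised polynomials subconverge, real roots of the
  limit may be dropped, and the parity of the number of roots is that of the degree of the map. So the
  closure consists of all maps given by \<open>n\<close> non-real roots, and the degree is the number of
  roots in the lower half plane minus the number in the upper one.

  Moving the roots along straight lines to \<open>\<plusminus>\<i>\<close> contracts the set of maps of a given
  degree. For two maps with roots \<open>L\<close> and \<open>M\<close> of the same degree let \<open>h\<close> be the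
  quotient of their polynomials after the roots in the lower half plane have been reflected into
  denominators. It is holomorphic in the lower half plane, and the motion for time \<open>t\<close> replaces
  \<open>h(x)\<close> by \<open>h((x - t\<i>) / (1 - t))\<close>. If the two maps are uniformly close, then \<open>h\<close> takes
  the real line into a narrow sector, hence by the maximum principle also the lower half plane. So the
  motion does not increase the uniform distance, and in particular it does not depend on the choice of
  the roots.\<close>

subsection \<open>The degree of a self-map of the circle as a winding number\<close>

text \<open>A map has no canonical list of roots, because conjugate pairs may be inserted or
  cancelled. The homotopy is therefore defined through an arbitrary choice of one list for each map,
  with no continuity assumed. The estimate on uniform distances repairs this: it gives continuity in
  the map, while continuity in time is elementary for a single fixed list. Two bounds shape that
  estimate. A distance below 2, the diameter of the circle, keeps \<open>h\<close> off the imaginary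
  axis on the real line, and the limit 1 of \<open>h\<close> at infinity then selects the sector
  around the positive axis. This limit requires equally many roots in each half plane, which equal
  length and equal degree of the lists guarantee. Maps are compared through
  \<open>z / cnj z\<close>, which is blind to real scalars and extends over infinity. The degree is
  defined by homology, while roots produce winding numbers; this gap has to be bridged before roots
  can be counted.\<close>

lemma winding_number_continuous_log:
  assumes p: "path p" "\<zeta> \<notin> path_image p" and q: "continuous_on {0..1} q"
    and pq: "\<And>t. t \<in> {0..1} \<Longrightarrow> p t = \<zeta> + exp (q t)"
  shows "2 * of_real pi * \<i> * winding_number p \<zeta> = q 1 - q 0"
proof -
  obtain r where r: "path r"
      "pathfinish r - pathstart r = 2 * of_real pi * \<i> * winding_number p \<zeta>"
      "\<And>t. t \<in> {0..1} \<Longrightarrow> p t = \<zeta> + exp (r t)"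
    using winding_number_as_continuous_log [OF p] by blast
  \<comment> \<open>Two logarithms of the same path differ by a continuous function with values in
    the integer multiples of \<open>2 * pi * \<i>\<close>. Distinct values are at least
    \<open>2 * pi\<close> apart, so on the connected interval there is only one.\<close>
  have "(\<lambda>t. q t - r t) constant_on {0..1}"
  proof (rule continuous_discrete_range_constant)
    show "continuous_on {0..1} (\<lambda>t. q t - r t)"
      using q r(1) by (auto simp: path_def intro!: continuous_intros)
    fix x :: real assume x: "x \<in> {0..1}"
    have "2 * pi \<le> cmod (q y - r y - (q x - r x))"
      if y: "y \<in> {0..1}" and ne: "q y - r y \<noteq> q x - r x" for y
    proof -
      have "exp (q x - r x) = 1" "exp (q y - r y) = 1"
        using pq[OF x] pq[OF y] r(3)[OF x] r(3)[OF y] by (simp_all add: exp_diff)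
      then have "exp (q y - r y - (q x - r x)) = 1"
        by (simp add: exp_diff)
      then obtain n :: int where n: "Re (q y - r y - (q x - r x)) = 0"
          "Im (q y - r y - (q x - r x)) = of_int (2 * n) * pi"
        by (auto simp: exp_eq_1)
      then have "q y - r y - (q x - r x) = of_real (of_int (2 * n) * pi) * \<i>"
        by (simp add: complex_eq_iff)
      moreover from this ne have "n \<noteq> 0" by auto
      ultimately show ?thesis
        by (simp add: norm_mult abs_mult)
    qed
    then show "\<exists>e>0. \<forall>y. y \<in> {0..1} \<and> q y - r y \<noteq> q x - r x \<longrightarrow> e \<le> cmod (q y - r y - (q x - r x))"
      by (intro exI[of _ "2 * pi"]) auto
  qed simp
  then have "q 1 - r 1 = q 0 - r 0"
    by (force simp: constant_on_def)
  with r(2) show ?thesis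
    by (simp add: pathfinish_def pathstart_def algebra_simps)
qed

section \<open>The winding number as a cocycle on singular chains of the circle\<close>

definition plane_point :: "(nat \<Rightarrow> real) \<Rightarrow> complex" where
  "plane_point v = Complex (v 0) (v 1)"

definition circle_point :: "real \<Rightarrow> nat \<Rightarrow> real" where
  "circle_point t = (\<lambda>i. if i = 0 then cos (2 * pi * t) else if i = 1 then sin (2 * pi * t) else 0)"

definition edge_point :: "real \<Rightarrow> nat \<Rightarrow> real" where
  "edge_point t = (\<lambda>i. if i = 0 then 1 - t else if i = 1 then t else 0)"

text \<open>A single simplex is in general an open path, whose winding number is the change of a
  logarithm divided by \<open>2 * pi * \<i>\<close>; hence the complex values here and in
  \<open>chain_winding\<close>.\<close>

definition simplex_winding :: "((nat \<Rightarrow> real) \<Rightarrow> nat \<Rightarrow> real) \<Rightarrow> complex" where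
  "simplex_winding \<sigma> = winding_number (\<lambda>t. plane_point (\<sigma> (edge_point t))) 0"

definition chain_winding :: "(nat \<Rightarrow> real) chain \<Rightarrow> complex" where
  "chain_winding c =
    (\<Sum>\<sigma>\<in>Poly_Mapping.keys c. of_int (Poly_Mapping.lookup c \<sigma>) * simplex_winding \<sigma>)"

lemma chain_winding_superset:
  assumes "finite A" "Poly_Mapping.keys c \<subseteq> A"
  shows "chain_winding c = (\<Sum>\<sigma>\<in>A. of_int (Poly_Mapping.lookup c \<sigma>) * simplex_winding \<sigma>)"
  unfolding chain_winding_def using assms
  by (intro sum.mono_neutral_left) (auto simp: in_keys_iff)

lemma chain_winding_add: "chain_winding (a + b) = chain_winding a + chain_winding b"
proof -
  let ?A = "Poly_Mapping.keys a \<union> Poly_Mapping.keys b"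
  show ?thesis
    using keys_add[of a b]
    by (simp add: chain_winding_superset[of ?A] lookup_add algebra_simps sum.distrib)
qed

lemma chain_winding_minus: "chain_winding (- a) = - chain_winding a"
  by (simp add: chain_winding_def sum_negf)

lemma chain_winding_diff: "chain_winding (a - b) = chain_winding a - chain_winding b"
  using chain_winding_add[of a "- b"] by (simp add: chain_winding_minus)

lemma chain_winding_of: "chain_winding (frag_of \<sigma>) = simplex_winding \<sigma>"
  by (simp add: chain_winding_def)

lemma chain_winding_cmul: "chain_winding (frag_cmul k a) = of_int k * chain_winding a"
  by (subst chain_winding_superset[of "Poly_Mapping.keys a"])
    (auto simp: chain_winding_def sum_distrib_left mult.assoc in_keys_iff)

lemma continuous_map_plane_point:
  assumes "continuous_map X euclidean (\<lambda>v. v 0)" "continuous_map X euclidean (\<lambda>v. v 1)"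
  shows "continuous_map X euclidean plane_point"
proof -
  have "continuous_map X euclidean (\<lambda>v. (v 0, v 1))"
    using continuous_map_pairedI[OF assms] by (simp flip: euclidean_product_topology)
  moreover have "continuous_map euclidean euclidean (\<lambda>(x, y). Complex x y)"
    by (simp add: Complex_eq case_prod_unfold continuous_map_iff_continuous2) (intro continuous_intros)
  ultimately have "continuous_map X euclidean ((\<lambda>(x, y). Complex x y) \<circ> (\<lambda>v. (v 0, v 1)))"
    by (rule continuous_map_compose)
  then show ?thesis
    by (simp add: o_def plane_point_def [abs_def])
qed

lemma continuous_map_plane_point_nsphere: "continuous_map (nsphere 1) euclidean plane_point"
  by (intro continuous_map_plane_point continuous_map_nsphere_projection)

lemma plane_point_nz: "v \<in> topspace (nsphere 1) \<Longrightarrow> plane_point v \<noteq> 0"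
  by (auto simp: nsphere plane_point_def complex_eq_iff)

text \<open>A triangle is contractible, so the map from it to the non-zero complex numbers has a
  logarithm \<open>g\<close>. Each edge contributes a difference of values of \<open>g\<close> at
  two vertices, and the alternating sum over the faces cancels.\<close>

lemma chain_winding_boundary_simplex:
  assumes \<sigma>: "singular_simplex 2 (nsphere 1) \<sigma>"
  shows "chain_winding (chain_boundary 2 (frag_of \<sigma>)) = 0"
proof -
  \<comment> \<open>A planar model of the standard 2-simplex with vertices 0, 1 and \<i>, so that
    the logarithm theorem for contractible sets applies; \<open>\<tau>\<close> gives barycentric
    coordinates. Face \<open>k\<close> becomes the edge opposite to vertex \<open>k\<close>.\<close>
  define T where "T = {z::complex. 0 \<le> Re z \<and> 0 \<le> Im z \<and> Re z + Im z \<le> 1}"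
  define \<tau> where "\<tau> z = (\<lambda>i::nat. if i = 0 then 1 - Re z - Im z else if i = 1 then Re z else
      if i = 2 then Im z else 0 :: real)" for z :: complex
  have T: "T = {z. 0 \<le> Re z} \<inter> {z. 0 \<le> Im z} \<inter> {z. Re z + Im z \<le> 1}"
    by (auto simp: T_def)
  have "convex {z. Re z + Im z \<le> 1}"
    using convex_halfspace_le[of "Complex 1 1" 1] by (simp add: inner_complex_def)
  then have "convex T"
    unfolding T by (intro convex_Int convex_halfspace_Re_ge convex_halfspace_Im_ge)
  have sum2: "(\<Sum>i\<le>2::nat. f i) = f 0 + f 1 + f 2" for f :: "nat \<Rightarrow> real"
    by (simp add: numeral_2_eq_2)
  have \<tau>T: "\<tau> z \<in> standard_simplex 2" if "z \<in> T" for z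
    using that by (auto simp: standard_simplex_def \<tau>_def T_def sum2)
  have "continuous_map (top_of_set T) (subtopology (powertop_real UNIV) (standard_simplex 2)) \<tau>"
    unfolding continuous_map_in_subtopology
  proof
    have "continuous_on T (\<lambda>z. \<tau> z k)" for k
      by (cases "k = 0"; cases "k = 1"; cases "k = 2") (auto simp: \<tau>_def intro!: continuous_intros)
    then show "continuous_map (top_of_set T) (powertop_real UNIV) \<tau>"
      by (simp add: continuous_map_componentwise_UNIV)
    show "\<tau> \<in> topspace (top_of_set T) \<rightarrow> standard_simplex 2"
      using \<tau>T by auto
  qed
  moreover have "continuous_map (subtopology (powertop_real UNIV) (standard_simplex 2)) (nsphere 1) \<sigma>"
    using \<sigma> by (simp add: singular_simplex_def)
  ultimately have "continuous_map (top_of_set T) (nsphere 1) (\<sigma> \<circ> \<tau>)"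
    using continuous_map_compose by blast
  then have "continuous_map (top_of_set T) euclidean (plane_point \<circ> (\<sigma> \<circ> \<tau>))"
    by (rule continuous_map_compose [OF _ continuous_map_plane_point_nsphere])
  then have cont: "continuous_on T (\<lambda>z. plane_point (\<sigma> (\<tau> z)))"
    by (simp add: o_def)
  have nz: "plane_point (\<sigma> (\<tau> z)) \<noteq> 0" if "z \<in> T" for z
  proof (rule plane_point_nz)
    show "\<sigma> (\<tau> z) \<in> topspace (nsphere 1)"
      using \<open>continuous_map (top_of_set T) (nsphere 1) (\<sigma> \<circ> \<tau>)\<close> that
      by (auto simp: continuous_map_def Pi_iff)
  qed
  obtain g where g: "continuous_on T g" "\<And>z. z \<in> T \<Longrightarrow> plane_point (\<sigma> (\<tau> z)) = exp (g z)"
    using continuous_logarithm_on_contractible [OF cont convex_imp_contractible [OF \<open>convex T\<close>] nz]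
    by blast
  have edge: "2 * of_real pi * \<i> * simplex_winding (singular_face 2 k \<sigma>) = g (e 1) - g (e 0)"
    if e: "\<And>t. t \<in> {0..1} \<Longrightarrow> simplical_face k (edge_point t) = \<tau> (e t)"
      "\<And>t. t \<in> {0..1} \<Longrightarrow> e t \<in> T" "continuous_on {0..1} e" for e k
  proof -
    have "edge_point t \<in> standard_simplex 1" if "t \<in> {0..1}" for t
      using that by (auto simp: standard_simplex_def edge_point_def)
    then have eq: "plane_point (singular_face 2 k \<sigma> (edge_point t)) = exp (g (e t))" if "t \<in> {0..1}" for t
      using that e g(2) by (simp add: singular_face_def)
    have c: "continuous_on {0..1} (\<lambda>t. g (e t))"
      by (rule continuous_on_compose2 [OF g(1) e(3)]) (use e(2) in auto)
    have "path (\<lambda>t. plane_point (singular_face 2 k \<sigma> (edge_point t)))"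
      unfolding path_def by (subst continuous_on_cong [OF refl eq]) (auto intro!: continuous_intros c)
    moreover have "0 \<notin> path_image (\<lambda>t. plane_point (singular_face 2 k \<sigma> (edge_point t)))"
      using eq by (auto simp: path_image_def)
    ultimately show ?thesis
      unfolding simplex_winding_def
      using winding_number_continuous_log [OF _ _ c] eq by simp
  qed
  have [simp]: "Complex 0 1 = \<i>" "Complex 1 0 = 1" "Complex 0 0 = 0"
    by (simp_all add: complex_eq_iff)
  have "simplical_face 0 (edge_point t) = \<tau> (Complex (1 - t) t)" for t
    by (auto simp: simplical_face_def edge_point_def \<tau>_def fun_eq_iff)
  moreover have "continuous_on {0..1} (\<lambda>t. Complex (1 - t) t)"
    by (simp add: Complex_eq) (intro continuous_intros)
  ultimately have e0: "2 * of_real pi * \<i> * simplex_winding (singular_face 2 0 \<sigma>) = g \<i> - g 1"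
    using edge[of 0 "\<lambda>t. Complex (1 - t) t"] by (auto simp: T_def)
  have "simplical_face 1 (edge_point t) = \<tau> (Complex 0 t)" for t
    by (auto simp: simplical_face_def edge_point_def \<tau>_def fun_eq_iff)
  moreover have "continuous_on {0..1} (\<lambda>t. Complex 0 t)"
    by (simp add: Complex_eq) (intro continuous_intros)
  ultimately have e1: "2 * of_real pi * \<i> * simplex_winding (singular_face 2 1 \<sigma>) = g \<i> - g 0"
    using edge[of 1 "\<lambda>t. Complex 0 t"] by (auto simp: T_def)
  have "simplical_face 2 (edge_point t) = \<tau> (Complex t 0)" for t
    by (auto simp: simplical_face_def edge_point_def \<tau>_def fun_eq_iff)
  moreover have "continuous_on {0..1} (\<lambda>t. Complex t 0)"
    by (simp add: Complex_eq)
  ultimately have e2: "2 * of_real pi * \<i> * simplex_winding (singular_face 2 2 \<sigma>) = g 1 - g 0"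
    using edge[of 2 "\<lambda>t. Complex t 0"] by (auto simp: T_def)
  have "chain_boundary 2 (frag_of \<sigma>) = frag_of (singular_face 2 0 \<sigma>) - frag_of (singular_face 2 1 \<sigma>)
      + frag_of (singular_face 2 2 \<sigma>)"
    by (simp add: chain_boundary_def numeral_2_eq_2)
  then have "chain_winding (chain_boundary 2 (frag_of \<sigma>)) = simplex_winding (singular_face 2 0 \<sigma>)
      - simplex_winding (singular_face 2 1 \<sigma>) + simplex_winding (singular_face 2 2 \<sigma>)"
    by (simp add: chain_winding_add chain_winding_diff chain_winding_of)
  then have "2 * of_real pi * \<i> * chain_winding (chain_boundary 2 (frag_of \<sigma>)) = 0"
    using e0 e1 e2 by (simp add: ring_distribs)
  then show ?thesis by simp
qed

lemma chain_winding_boundary: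
  assumes "singular_chain 2 (nsphere 1) c"
  shows "chain_winding (chain_boundary 2 c) = 0"
  using assms unfolding singular_chain_def
proof (induction c rule: frag_induction)
  case zero
  then show ?case by (simp add: chain_winding_def)
next
  case (one \<sigma>)
  then show ?case using chain_winding_boundary_simplex by simp
next
  case (diff a b)
  then show ?case by (simp add: chain_boundary_diff chain_winding_diff)
qed

lemma circle_point_in_nsphere: "circle_point t \<in> topspace (nsphere 1)"
  by (simp add: nsphere circle_point_def)

text \<open>The Brouwer degree is an exponent in a multiplicatively written quotient group, whereas
  winding numbers are evaluated on chains. This carries the exponent over to a scalar factor of a
  representing cycle.\<close>

lemma homologous_rel_set_int_pow:
  assumes "singular_relcycle p X {} c"
  shows "homologous_rel_set p X {} c [^]\<^bsub>homology_group (int p) X\<^esub> (k::int)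
       = homologous_rel_set p X {} (frag_cmul k c)"
proof -
  interpret N: normal "singular_relboundary_set p X {}" "relcycle_group p X {}"
    by (rule normal_subgroup_singular_relboundary_relcycle)
  have "c [^]\<^bsub>relcycle_group p X {}\<^esub> k = c [^]\<^bsub>chain_group p X\<^esub> k"
    unfolding relcycle_group_def
    by (rule group.int_pow_subgroup_generated)
      (use assms in \<open>auto simp flip: relcycle_group_def\<close>)
  also have "\<dots> = frag_cmul k c"
    using assms unfolding chain_group_def
    by (simp add: singular_cycle singular_chain_def)
  finally have "c [^]\<^bsub>relcycle_group p X {}\<^esub> k = frag_cmul k c" .
  then show ?thesis
    using N.FactGroup_int_pow [of c k] assms
    by (simp add: nontrivial_relative_homology_group right_coset_singular_relboundary)
qed

text \<open>The winding number is a cocycle on singular 1-chains of the circle, so it is defined on homology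
  classes; comparing its values on the image and on the multiple of the fundamental cycle gives the
  degree.\<close>

theorem Brouwer_degree2_winding_number:
  assumes f: "continuous_map (nsphere 1) (nsphere 1) f"
  shows "of_int (Brouwer_degree2 1 f) = winding_number (\<lambda>t. plane_point (f (circle_point t))) 0"
proof -
  \<comment> \<open>The simplex that runs once around the circle; its two end points coincide, which
    makes it a cycle. Singular simplices are extensional, hence the restriction.\<close>
  define \<sigma> where "\<sigma> = restrict (\<lambda>v. circle_point (v 1)) (standard_simplex 1)"
  have edge: "edge_point t \<in> standard_simplex 1" if "t \<in> {0..1}" for t
    using that by (auto simp: standard_simplex_def edge_point_def)
  have "continuous_map (subtopology (powertop_real UNIV) (standard_simplex 1)) (nsphere 1)
      (\<lambda>v. circle_point (v 1))"
  proof -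
    have c: "continuous_map (subtopology (powertop_real UNIV) (standard_simplex 1)) euclidean (\<lambda>v. v 1)"
      by (intro continuous_map_from_subtopology continuous_map_product_projection) simp
    have "continuous_map (subtopology (powertop_real UNIV) (standard_simplex 1)) euclidean
        (\<lambda>v. h (v 1))" if "continuous_on UNIV h" for h :: "real \<Rightarrow> real"
      using continuous_map_compose[OF c, of euclidean h] that by (simp add: o_def)
    moreover have "continuous_on UNIV (\<lambda>t. circle_point t i)" for i
      by (cases "i = 0"; cases "i = 1") (auto simp: circle_point_def intro!: continuous_intros)
    ultimately have "continuous_map (subtopology (powertop_real UNIV) (standard_simplex 1)) euclidean
        (\<lambda>v. circle_point (v 1) i)" for i
      by blast
    then show ?thesis
      unfolding nsphere continuous_map_in_subtopology continuous_map_componentwise_UNIV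
      using circle_point_in_nsphere by (auto simp: nsphere)
  qed
  then have \<sigma>: "singular_simplex 1 (nsphere 1) \<sigma>"
    by (auto simp: singular_simplex_def \<sigma>_def)
  have "singular_face 1 0 \<sigma> = singular_face 1 1 \<sigma>"
  proof
    fix v
    show "singular_face 1 0 \<sigma> v = singular_face 1 1 \<sigma> v"
      using simplical_face_in_standard_simplex[of 1 0 v] simplical_face_in_standard_simplex[of 1 1 v]
      by (auto simp: singular_face_def \<sigma>_def simplical_face_def circle_point_def standard_simplex_def)
  qed
  then have "chain_boundary 1 (frag_of \<sigma>) = 0"
    by (simp add: chain_boundary_def)
  with \<sigma> have cyc: "singular_relcycle 1 (nsphere 1) {} (frag_of \<sigma>)"
    by (simp add: singular_cycle singular_chain_def)
  let ?H = "homology_group 1 (nsphere 1)"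
  let ?d = "Brouwer_degree2 1 f"
  let ?x = "homologous_rel_set 1 (nsphere 1) {} (frag_of \<sigma>)"
  \<comment> \<open>The degree is defined on reduced homology, which agrees with ordinary homology
    in dimension 1.\<close>
  have red: "reduced_homology_group (int 1) (nsphere 1) = ?H"
    by (simp add: un_reduced_homology_group)
  have "?x \<in> carrier ?H"
    using carrier_relative_homology_group[of 1] cyc by auto
  then have "hom_induced 1 (nsphere 1) {} (nsphere 1) {} f ?x = ?x [^]\<^bsub>?H\<^esub> ?d"
    using Brouwer_degree2[of ?x 1 f] by (simp add: red[simplified])
  moreover have "hom_induced 1 (nsphere 1) {} (nsphere 1) {} f ?x
      = homologous_rel_set 1 (nsphere 1) {} (chain_map 1 f (frag_of \<sigma>))"
    using hom_induced_chain_map[of "nsphere 1" "nsphere 1" f "{}" "{}" 1, OF f _ cyc] by simp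
  ultimately have "homologous_rel_set 1 (nsphere 1) {} (chain_map 1 f (frag_of \<sigma>))
      = homologous_rel_set 1 (nsphere 1) {} (frag_cmul ?d (frag_of \<sigma>))"
    using homologous_rel_set_int_pow[OF cyc, of ?d] by simp
  then have "homologous_rel 1 (nsphere 1) {} (chain_map 1 f (frag_of \<sigma>)) (frag_cmul ?d (frag_of \<sigma>))"
    by (simp add: homologous_rel_set_eq)
  then obtain e where e: "singular_chain 2 (nsphere 1) e"
      "chain_boundary 2 e = chain_map 1 f (frag_of \<sigma>) - frag_cmul ?d (frag_of \<sigma>)"
    by (auto simp: homologous_rel_def singular_boundary numeral_2_eq_2)
  have "chain_winding (chain_map 1 f (frag_of \<sigma>)) = of_int ?d * chain_winding (frag_of \<sigma>)"
    using chain_winding_boundary[OF e(1)] by (simp add: e(2) chain_winding_diff chain_winding_cmul)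
  moreover have "chain_winding (frag_of \<sigma>) = 1"
  proof -
    let ?p = "\<lambda>t. plane_point (\<sigma> (edge_point t))"
    have eq: "?p t = exp (2 * of_real pi * \<i> * of_real t)" if "t \<in> {0..1}" for t
      using edge[OF that]
      by (simp add: \<sigma>_def plane_point_def circle_point_def edge_point_def complex_eq_iff Re_exp Im_exp)
    have c: "continuous_on {0..1} (\<lambda>t. 2 * of_real pi * \<i> * complex_of_real t)"
      by (intro continuous_intros)
    have "path ?p"
      unfolding path_def by (subst continuous_on_cong [OF refl eq]) (auto intro!: continuous_intros)
    moreover have "0 \<notin> path_image ?p"
      using eq by (auto simp: path_image_def)
    ultimately have "2 * of_real pi * \<i> * winding_number ?p 0 = 2 * of_real pi * \<i>"
      using winding_number_continuous_log [OF _ _ c] eq by simp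
    then show ?thesis
      by (simp add: chain_winding_of simplex_winding_def)
  qed
  moreover have "chain_winding (chain_map 1 f (frag_of \<sigma>))
      = winding_number (\<lambda>t. plane_point (f (circle_point t))) 0"
  proof -
    have "simplex_winding (simplex_map 1 f \<sigma>) = winding_number (\<lambda>t. plane_point (f (circle_point t))) 0"
      unfolding simplex_winding_def
      by (rule winding_number_cong) (use edge in \<open>auto simp: simplex_map_def \<sigma>_def edge_point_def\<close>)
    then show ?thesis
      by (simp add: chain_map_of chain_winding_of)
  qed
  ultimately show ?thesis by simp
qed

subsection \<open>The compact-open topology as a uniform topology\<close>

text \<open>The image of \<open>V\<close> is the trace of an open set \<open>W\<close>, and the
  compact image of \<open>C\<close> inside \<open>W\<close> has a neighbourhood of uniform radius in
  \<open>W\<close>. With \<open>C\<close> the image of a compact set, this puts a uniform ball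
  inside a subbasic open set.\<close>

lemma embedding_map_compact_nbhd:
  fixes e :: "'b \<Rightarrow> 'm::heine_borel"
  assumes e: "embedding_map Y euclidean e" and V: "openin Y V" and C: "compactin Y C" "C \<subseteq> V"
  obtains \<epsilon> where "\<epsilon> > 0"
    "\<And>y y'. y \<in> C \<Longrightarrow> y' \<in> topspace Y \<Longrightarrow> dist (e y') (e y) < \<epsilon> \<Longrightarrow> y' \<in> V"
proof -
  have hom: "homeomorphic_map Y (top_of_set (e ` topspace Y)) e"
    using e by (simp add: embedding_map_def)
  then have inj: "inj_on e (topspace Y)" and "openin (top_of_set (e ` topspace Y)) (e ` V)"
    using V by (auto simp: homeomorphic_eq_everything_map open_map_def)
  then obtain W where W: "open W" "e ` V = e ` topspace Y \<inter> W"
    by (auto simp: openin_open)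
  have "continuous_map Y euclidean e"
    using e continuous_map_in_subtopology homeomorphic_imp_continuous_map
    unfolding embedding_map_def by blast
  then have "compact (e ` C)"
    using image_compactin[OF C(1)] compactin_euclidean_iff by blast
  moreover have "e ` C \<subseteq> W"
    using C W by blast
  ultimately obtain \<epsilon> where \<epsilon>: "\<epsilon> > 0" "(\<Union>x\<in>e ` C. ball x \<epsilon>) \<subseteq> W"
    using compact_subset_open_imp_ball_epsilon_subset W(1) by blast
  show ?thesis
  proof (rule that [OF \<epsilon>(1)])
    fix y y' assume y: "y \<in> C" "y' \<in> topspace Y" "dist (e y') (e y) < \<epsilon>"
    then have "e y' \<in> e ` V"
      using \<epsilon>(2) W(2) by (fastforce simp: dist_commute)
    then show "y' \<in> V"
      using inj y(2) openin_subset[OF V] by (auto simp: inj_on_def)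
  qed
qed

text \<open>Uniform balls refine subbasic sets, hence by induction all generated open sets.
  Conversely, compactness of the source covers the image of \<open>f\<close> by finitely many small
  balls, and the corresponding finitely many subbasic conditions confine a map to a uniform ball
  around \<open>f\<close>.\<close>

theorem openin_compact_open_topology_iff:
  fixes e :: "'b \<Rightarrow> 'm::heine_borel"
  assumes X: "compact_space X" and e: "embedding_map Y euclidean e"
  shows "openin (compact_open_topology X Y) U \<longleftrightarrow>
    U \<subseteq> continuous_maps X Y \<and>
    (\<forall>f\<in>U. \<exists>\<epsilon>>0. \<forall>f'\<in>continuous_maps X Y.
       (\<forall>x\<in>topspace X. dist (e (f' x)) (e (f x)) < \<epsilon>) \<longrightarrow> f' \<in> U)"
    (is "?lhs \<longleftrightarrow> ?rhs")
proof
  let ?B = "{{f \<in> continuous_maps X Y. f ` K \<subseteq> U} | K U. compactin X K \<and> openin Y U}"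
  assume L: ?lhs
  then have "generate_topology_on ?B U"
    unfolding compact_open_topology_def by (rule openin_topology_generated_by)
  then have "\<forall>f\<in>U. \<exists>\<epsilon>>0. \<forall>f'\<in>continuous_maps X Y.
       (\<forall>x\<in>topspace X. dist (e (f' x)) (e (f x)) < \<epsilon>) \<longrightarrow> f' \<in> U"
  proof induction
    case (Int U V)
    show ?case
    proof
      fix f assume f: "f \<in> U \<inter> V"
      then obtain a b where "a > 0" "b > 0"
        and "\<forall>f'\<in>continuous_maps X Y. (\<forall>x\<in>topspace X. dist (e (f' x)) (e (f x)) < a) \<longrightarrow> f' \<in> U"
        and "\<forall>f'\<in>continuous_maps X Y. (\<forall>x\<in>topspace X. dist (e (f' x)) (e (f x)) < b) \<longrightarrow> f' \<in> V"
        using Int.IH by (metis IntE)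
      then show "\<exists>\<epsilon>>0. \<forall>f'\<in>continuous_maps X Y.
          (\<forall>x\<in>topspace X. dist (e (f' x)) (e (f x)) < \<epsilon>) \<longrightarrow> f' \<in> U \<inter> V"
        by (intro exI[of _ "min a b"]) auto
    qed
  next
    case (UN K)
    show ?case
    proof
      fix f assume "f \<in> \<Union>K"
      then obtain k where "k \<in> K" "f \<in> k" by blast
      with UN.IH[of k] show "\<exists>\<epsilon>>0. \<forall>f'\<in>continuous_maps X Y.
          (\<forall>x\<in>topspace X. dist (e (f' x)) (e (f x)) < \<epsilon>) \<longrightarrow> f' \<in> \<Union>K"
        by (meson UnionI)
    qed
  next
    case (Basis S)
    then obtain K V where S: "S = {f \<in> continuous_maps X Y. f ` K \<subseteq> V}"
      and K: "compactin X K" and V: "openin Y V" by blast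
    show ?case
    proof
      fix f assume f: "f \<in> S"
      then have "compactin Y (f ` K)" "f ` K \<subseteq> V"
        using K S image_compactin by (auto simp: continuous_maps_def)
      then obtain \<epsilon> where \<epsilon>: "\<epsilon> > 0"
        "\<And>y y'. y \<in> f ` K \<Longrightarrow> y' \<in> topspace Y \<Longrightarrow> dist (e y') (e y) < \<epsilon> \<Longrightarrow> y' \<in> V"
        using embedding_map_compact_nbhd[OF e V] by blast
      have "f' \<in> S" if "f' \<in> continuous_maps X Y"
        and d: "\<forall>x\<in>topspace X. dist (e (f' x)) (e (f x)) < \<epsilon>" for f'
      proof -
        have "K \<subseteq> topspace X" using K compactin_subset_topspace by blast
        moreover have "f' x \<in> topspace Y" if "x \<in> topspace X" for x
          using \<open>f' \<in> continuous_maps X Y\<close> that by (auto simp: continuous_maps_def continuous_map_def)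
        ultimately show ?thesis
          using \<epsilon>(2) d that(1) S by blast
      qed
      then show "\<exists>\<epsilon>>0. \<forall>f'\<in>continuous_maps X Y.
          (\<forall>x\<in>topspace X. dist (e (f' x)) (e (f x)) < \<epsilon>) \<longrightarrow> f' \<in> S"
        using \<epsilon>(1) by blast
    qed
  qed simp
  then show ?rhs
    using openin_subset[OF L] by simp
next
  assume R: ?rhs
  have ce: "continuous_map Y euclidean e"
    using e continuous_map_in_subtopology homeomorphic_imp_continuous_map
    unfolding embedding_map_def by blast
  show ?lhs
  proof (subst openin_subopen, intro ballI)
    fix f assume f: "f \<in> U"
    then have fC: "f \<in> continuous_maps X Y" using R by blast
    obtain \<epsilon> where \<epsilon>: "\<epsilon> > 0" "\<And>f'. f' \<in> continuous_maps X Y \<Longrightarrow>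
        (\<forall>x\<in>topspace X. dist (e (f' x)) (e (f x)) < \<epsilon>) \<Longrightarrow> f' \<in> U"
      using R f by meson
    have cef: "continuous_map X euclidean (\<lambda>x. e (f x))"
      using fC ce continuous_map_compose[of X Y f euclidean e] by (simp add: continuous_maps_def o_def)
    then have "compact ((\<lambda>x. e (f x)) ` topspace X)"
      using image_compactin X compactin_euclidean_iff compact_space_def by blast
    then obtain A where A: "finite A" "A \<subseteq> (\<lambda>x. e (f x)) ` topspace X"
        "(\<lambda>x. e (f x)) ` topspace X \<subseteq> (\<Union>a\<in>A. ball a (\<epsilon> / 4))"
      by (rule compactE_image[of _ _ "\<lambda>a. ball a (\<epsilon> / 4)"]) (use \<epsilon>(1) in auto)
    \<comment> \<open>Closed balls make \<open>K a\<close> compact, and the larger open radius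
      \<open>\<epsilon> / 2\<close> in the target admits \<open>f\<close> itself. The final distance
      is below \<open>\<epsilon> / 4 + \<epsilon> / 2\<close>.\<close>
    define K where "K a = {x \<in> topspace X. e (f x) \<in> cball a (\<epsilon> / 4)}" for a
    define V where "V a = {y \<in> topspace Y. e y \<in> ball a (\<epsilon> / 2)}" for a
    have K: "compactin X (K a)" for a
    proof -
      have "closedin X (K a)"
        unfolding K_def using closedin_continuous_map_preimage[OF cef, of "cball a (\<epsilon> / 4)"]
        by (simp only: closed_closedin[symmetric] closed_cball)
      then show ?thesis using X closedin_compact_space by blast
    qed
    have V: "openin Y (V a)" for a
      unfolding V_def using openin_continuous_map_preimage[OF ce, of "ball a (\<epsilon> / 2)"]
      by (simp only: open_openin[symmetric] open_ball)
    \<comment> \<open>The last intersectand covers the case of an empty \<open>A\<close>.\<close>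
    define T where "T = (\<Inter>a\<in>A. {f \<in> continuous_maps X Y. f ` K a \<subseteq> V a}) \<inter> continuous_maps X Y"
    have "openin (compact_open_topology X Y) {f \<in> continuous_maps X Y. f ` K a \<subseteq> V a}" for a
      unfolding compact_open_topology_def by (rule topology_generated_by_Basis) (use K V in blast)
    then have "openin (compact_open_topology X Y) T"
      using openin_INT[OF A(1), of "compact_open_topology X Y" "\<lambda>a. {f \<in> continuous_maps X Y. f ` K a \<subseteq> V a}"]
      by (simp add: T_def)
    moreover have "f \<in> T"
    proof -
      have "f x \<in> topspace Y" if "x \<in> topspace X" for x
        using fC that by (auto simp: continuous_maps_def continuous_map_def)
      then show ?thesis
        using fC \<epsilon>(1) by (auto simp: T_def K_def V_def)
    qed
    moreover have "T \<subseteq> U"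
    proof
      fix f' assume f': "f' \<in> T"
      have "dist (e (f' x)) (e (f x)) < \<epsilon>" if x: "x \<in> topspace X" for x
      proof -
        obtain a where a: "a \<in> A" "dist a (e (f x)) < \<epsilon> / 4"
          using A(3) x by auto
        then have "x \<in> K a" using x by (simp add: K_def)
        then have "f' x \<in> V a" using f' a(1) by (auto simp: T_def)
        then have "dist a (e (f' x)) < \<epsilon> / 2" by (simp add: V_def)
        with a(2) \<epsilon>(1) show ?thesis
          by metric
      qed
      then show "f' \<in> U" using \<epsilon>(2) f' by (auto simp: T_def)
    qed
    ultimately show "\<exists>T. openin (compact_open_topology X Y) T \<and> f \<in> T \<and> T \<subseteq> U" by blast
  qed
qed

subsection \<open>Non-expansiveness of the contraction of the roots\<close>

text \<open>The half plane is unbounded, so the maximum principle is applied on half discs. The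
  limit of \<open>Re (c * h)\<close> at infinity is non-negative, being also a limit along the real
  axis; so on large arcs the real part exceeds \<open>- e\<close>, and \<open>e\<close> is
  arbitrary.\<close>

lemma Re_nonneg_lower_half_plane:
  fixes h :: "complex \<Rightarrow> complex"
  assumes hol: "h holomorphic_on {z. Im z < 0}" and cont: "continuous_on {z. Im z \<le> 0} h"
    and lim: "(h \<longlongrightarrow> l) at_infinity"
    and re: "\<And>x::real. 0 \<le> Re (c * h (of_real x))" and z: "Im z \<le> 0"
  shows "0 \<le> Re (c * h z)"
proof (rule field_le_epsilon)
  fix e :: real assume e: "e > 0"
  have limc: "((\<lambda>z. Re (c * h z)) \<longlongrightarrow> Re (c * l)) at_infinity"
    by (intro tendsto_intros lim)
  have "((\<lambda>x. Re (c * h (of_real x))) \<longlongrightarrow> Re (c * l)) at_top"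
    by (rule filterlim_compose [OF limc filterlim_of_real_at_infinity])
  then have "0 \<le> Re (c * l)"
    by (rule tendsto_lowerbound [OF _ always_eventually trivial_limit_at_top_linorder]) (intro allI re)
  then have "\<forall>\<^sub>F w in at_infinity. Re (c * h w) > - e"
    using e by (intro order_tendstoD(1) [OF limc]) auto
  then obtain b where b: "\<And>w. b \<le> norm w \<Longrightarrow> Re (c * h w) > - e"
    by (auto simp: eventually_at_infinity)
  \<comment> \<open>The radius is large enough both for the bound on the arc and for the half disc
    to contain \<open>z\<close>.\<close>
  define M where "M = max b (norm z)"
  define S where "S = cball 0 M \<inter> {w. Im w \<le> 0}"
  have clos: "closed {w. Im w \<le> 0}"
    by (rule closed_halfspace_Im_le)
  have int: "interior {w. Im w \<le> 0} = {w. Im w < 0}"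
    using interior_halfspace_le[of \<i> 0] by (simp add: inner_complex_def)
  have "frontier S \<subseteq> sphere 0 M \<union> frontier {w. Im w \<le> 0}"
    unfolding S_def using frontier_Int_subset[of "cball 0 M" "{w. Im w \<le> 0}"] by simp
  also have "frontier {w. Im w \<le> 0} = {w. Im w = 0}"
    using clos int by (auto simp: frontier_def)
  finally have front: "frontier S \<subseteq> sphere 0 M \<union> {w. Im w = 0}" .
  have "Re (- c * h z) \<le> e"
  proof (rule maximum_real_frontier [of "\<lambda>w. - c * h w" S])
    show "(\<lambda>w. - c * h w) holomorphic_on interior S"
      by (intro holomorphic_intros holomorphic_on_subset [OF hol]) (auto simp: S_def int)
    have "closure S = S"
      unfolding S_def using clos by (intro closure_closed closed_Int) auto
    then show "continuous_on (closure S) (\<lambda>w. - c * h w)"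
      by (auto intro!: continuous_intros continuous_on_subset [OF cont] simp: S_def)
    show "bounded S"
      unfolding S_def by (simp add: bounded_Int)
    show "z \<in> S"
      using z by (auto simp: S_def M_def)
    fix w assume "w \<in> frontier S"
    then consider "norm w = M" | "Im w = 0"
      using front by auto
    then show "Re (- c * h w) \<le> e"
    proof cases
      case 1
      then have "Re (c * h w) > - e" using b by (simp add: M_def)
      then show ?thesis by simp
    next
      case 2
      then have "w = of_real (Re w)" by (simp add: complex_eq_iff)
      then show ?thesis using re[of "Re w"] e by auto
    qed
  qed
  then show "0 \<le> Re (c * h z) + e" by simp
qed

text \<open>The condition describes a double sector around the real axis. Since
  \<open>s < 1\<close>, it meets the imaginary axis only at 0, which \<open>h\<close> avoids on the
  real line; as \<open>h\<close> tends to 1, the intermediate value theorem keeps \<open>h\<close>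
  in the right-hand sector there. That sector is an intersection of two half planes, and each is
  preserved separately.\<close>

lemma sector_lower_half_plane:
  fixes h :: "complex \<Rightarrow> complex"
  assumes hol: "h holomorphic_on {z. Im z < 0}" and cont: "continuous_on {z. Im z \<le> 0} h"
    and lim: "(h \<longlongrightarrow> 1) at_infinity"
    and nz: "\<And>x::real. h (of_real x) \<noteq> 0"
    and s: "s < 1" "\<And>x::real. \<bar>Im (h (of_real x))\<bar> \<le> s * norm (h (of_real x))" and z: "Im z \<le> 0"
  shows "\<bar>Im (h z)\<bar> \<le> s * norm (h z)"
proof -
  have s0: "0 \<le> s"
  proof -
    have "0 \<le> s * norm (h (of_real 0))"
      using s(2)[of 0] abs_ge_zero order_trans by blast
    moreover have "norm (h (of_real 0)) > 0"
      using nz[of 0] by simp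
    ultimately show ?thesis by (simp add: zero_le_mult_iff)
  qed
  \<comment> \<open>If \<open>s\<close> is the sine of the half-angle of the sector,
    \<open>k\<close> is its cosine.\<close>
  define k where "k = sqrt (1 - s\<^sup>2)"
  have "s\<^sup>2 < 1" using s(1) s0 by (simp add: power_less_one_iff abs_square_less_1)
  then have k: "k > 0" "k\<^sup>2 = 1 - s\<^sup>2"
    by (auto simp: k_def)
  have sector: "\<bar>Im w\<bar> \<le> s * norm w \<longleftrightarrow> k * \<bar>Im w\<bar> \<le> s * \<bar>Re w\<bar>" for w
  proof -
    have "\<bar>Im w\<bar> \<le> s * norm w \<longleftrightarrow> \<bar>Im w\<bar>\<^sup>2 \<le> (s * norm w)\<^sup>2"
      using s0 by (intro power_mono_iff[symmetric]) auto
    also have "\<dots> \<longleftrightarrow> (k * \<bar>Im w\<bar>)\<^sup>2 \<le> (s * \<bar>Re w\<bar>)\<^sup>2"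
      by (simp add: power_mult_distrib cmod_power2 k(2)) (simp add: algebra_simps)
    also have "\<dots> \<longleftrightarrow> k * \<bar>Im w\<bar> \<le> s * \<bar>Re w\<bar>"
      using s0 k by (intro power_mono_iff) auto
    finally show ?thesis .
  qed
  have re_nz: "Re (h (of_real x)) \<noteq> 0" for x
  proof
    assume "Re (h (of_real x)) = 0"
    then have "Im (h (of_real x)) = 0"
      using s(2)[of x] k(1) by (simp add: sector mult_le_0_iff)
    with \<open>Re (h (of_real x)) = 0\<close> nz[of x] show False by (simp add: complex_eq_iff)
  qed
  have re_pos: "Re (h (of_real x)) > 0" for x
  proof (rule ccontr)
    assume "\<not> ?thesis"
    with re_nz[of x] have neg: "Re (h (of_real x)) < 0" by simp
    have "((\<lambda>x. Re (h (of_real x))) \<longlongrightarrow> Re 1) at_top"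
      by (rule tendsto_Re [OF filterlim_compose [OF lim filterlim_of_real_at_infinity]])
    then have "\<forall>\<^sub>F x in at_top. Re (h (of_real x)) > 0"
      by (rule order_tendstoD) simp
    then obtain y where y: "y \<ge> x" "Re (h (of_real y)) > 0"
      by (metis eventually_at_top_linorder linorder_le_cases order.refl)
    have "continuous_on {x..y} (\<lambda>x. Re (h (of_real x)))"
      by (intro continuous_intros continuous_on_compose2 [OF cont]) auto
    then obtain u where "Re (h (of_real u)) = 0"
      using IVT'[of "\<lambda>x. Re (h (of_real x))" x 0 y] neg y by auto
    then show False using re_nz by blast
  qed
  \<comment> \<open>The two signs of \<open>t\<close> give the two half planes whose intersection is
    the right-hand sector.\<close>
  have half: "0 \<le> Re (Complex s t * h z)" if "\<bar>t\<bar> = k" for t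
  proof (rule Re_nonneg_lower_half_plane [OF hol cont lim _ z])
    fix x :: real
    have "k * \<bar>Im (h (of_real x))\<bar> \<le> s * Re (h (of_real x))"
      using s(2)[of x] re_pos[of x] by (simp add: sector)
    moreover have "\<bar>t * Im (h (of_real x))\<bar> = k * \<bar>Im (h (of_real x))\<bar>"
      using that by (simp add: abs_mult)
    ultimately show "0 \<le> Re (Complex s t * h (of_real x))" by simp
  qed
  have "k * \<bar>Im (h z)\<bar> \<le> s * Re (h z)"
    using half[of k] half[of "- k"] k(1) by (simp add: abs_if split: if_splits)
  also have "\<dots> \<le> s * \<bar>Re (h z)\<bar>"
    using s0 by (intro mult_left_mono) auto
  finally show ?thesis by (simp add: sector)
qed

section \<open>Root products, phases and the reflection of lower roots\<close>

definition root_prod :: "complex list \<Rightarrow> complex \<Rightarrow> complex" where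
  "root_prod L z = (\<Prod>a\<leftarrow>L. z - a)"

definition upper_roots :: "complex list \<Rightarrow> complex list" where
  "upper_roots L = filter (\<lambda>a. Im a > 0) L"

text \<open>Conjugated, so that these entries too lie in the upper half plane and their product has
  no zero in the closed lower one.\<close>

definition lower_roots :: "complex list \<Rightarrow> complex list" where
  "lower_roots L = map cnj (filter (\<lambda>a. Im a < 0) L)"

definition nonreal :: "complex list \<Rightarrow> bool" where
  "nonreal L \<longleftrightarrow> (\<forall>a\<in>set L. Im a \<noteq> 0)"

text \<open>This is \<open>u / cnj u\<close> for the value \<open>u\<close> of
  \<open>root_prod L\<close> at \<open>x\<close>, that is, the doubled argument of \<open>u\<close>.
  A conjugate pair of non-real roots contributes the factor 1.\<close>

definition phase :: "complex list \<Rightarrow> real \<Rightarrow> complex" where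
  "phase L x = (\<Prod>a\<leftarrow>L. (of_real x - a) / (of_real x - cnj a))"

definition root_quot :: "complex list \<Rightarrow> complex \<Rightarrow> complex" where
  "root_quot L z = root_prod (upper_roots L) z / root_prod (lower_roots L) z"

lemma root_prod_simps [simp]:
  "root_prod [] z = 1" "root_prod (a # L) z = (z - a) * root_prod L z"
  by (simp_all add: root_prod_def)

lemma root_prod_eq_0_iff: "root_prod L z = 0 \<longleftrightarrow> z \<in> set L"
  by (induction L) auto

lemma holomorphic_root_prod: "root_prod L holomorphic_on A"
proof (induction L)
  case Nil
  have "root_prod [] = (\<lambda>_. 1)" by auto
  then show ?case by simp
next
  case (Cons a L)
  have "root_prod (a # L) = (\<lambda>z. (z - a) * root_prod L z)" by auto
  then show ?case using Cons by (auto intro!: holomorphic_intros)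
qed

lemma root_prod_asymp: "((\<lambda>z. root_prod L z / z ^ length L) \<longlongrightarrow> 1) at_infinity"
proof (induction L)
  case (Cons a L)
  have "((\<lambda>z. (1 - a * inverse z) * (root_prod L z / z ^ length L)) \<longlongrightarrow> (1 - a * 0) * 1) at_infinity"
    by (intro tendsto_intros Cons tendsto_inverse_0)
  moreover have "\<forall>\<^sub>F z in at_infinity. (1 - a * inverse z) * (root_prod L z / z ^ length L)
      = root_prod (a # L) z / z ^ length (a # L)"
    using eventually_not_equal_at_infinity[of 0]
    by eventually_elim (simp add: field_simps)
  ultimately show ?case
    by (simp add: tendsto_cong)
qed simp

lemma root_quot_upper_nz:
  assumes "Im z \<le> 0"
  shows "root_prod (upper_roots L) z \<noteq> 0" "root_prod (lower_roots L) z \<noteq> 0"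
  using assms by (auto simp: root_prod_eq_0_iff upper_roots_def lower_roots_def)

text \<open>At a real point, \<open>x - a\<close> is a positive multiple of
  \<open>1 / (x - cnj a)\<close>, and \<open>u / cnj u\<close> does not see real multiples. So lower
  roots may be traded for reflected ones in the denominator.\<close>

lemma phase_root_quot:
  assumes "nonreal L"
  shows "phase L x = root_quot L (of_real x) / cnj (root_quot L (of_real x))"
  using assms
proof (induction L)
  case Nil
  then show ?case by (simp add: phase_def root_quot_def upper_roots_def lower_roots_def)
next
  case (Cons a L)
  then have a: "Im a \<noteq> 0" and IH: "phase L x = root_quot L (of_real x) / cnj (root_quot L (of_real x))"
    by (auto simp: nonreal_def)
  have ph: "phase (a # L) x = (of_real x - a) / (of_real x - cnj a) * phase L x"
    by (simp add: phase_def)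
  show ?case
  proof (cases "Im a > 0")
    case True
    then have "root_quot (a # L) (of_real x) = (of_real x - a) * root_quot L (of_real x)"
      by (simp add: root_quot_def upper_roots_def lower_roots_def)
    then show ?thesis by (simp add: ph IH)
  next
    case False
    then have "root_quot (a # L) (of_real x) = root_quot L (of_real x) / (of_real x - cnj a)"
      using a by (simp add: root_quot_def upper_roots_def lower_roots_def)
    then show ?thesis by (simp add: ph IH)
  qed
qed

text \<open>With \<open>h = u / v\<close> the left-hand norm equals
  \<open>norm (h - cnj h) / norm h\<close>. Uniform closeness of two maps thus becomes a sector
  condition on the quotient, with \<open>d / 2\<close> as the sine of the half-angle.\<close>

lemma norm_div_cnj_diff:
  assumes "u \<noteq> 0" "v \<noteq> 0"
  shows "norm (u / cnj u - v / cnj v) \<le> d \<longleftrightarrow> \<bar>Im (u / v)\<bar> \<le> d / 2 * norm (u / v)"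
proof -
  define h where "h = u / v"
  have h: "h \<noteq> 0" "u = h * v" using assms by (auto simp: h_def)
  have "u / cnj u - v / cnj v = (v / cnj v) * ((h - cnj h) / cnj h)"
    using assms h by (simp add: field_simps)
  then have "norm (u / cnj u - v / cnj v) = norm (h - cnj h) / norm h"
    using assms by (simp add: norm_mult norm_divide)
  also have "h - cnj h = of_real (2 * Im h) * \<i>"
    by (simp add: complex_eq_iff)
  also have "norm (of_real (2 * Im h) * \<i>) = 2 * \<bar>Im h\<bar>"
    by (simp add: norm_mult)
  finally show ?thesis
    using h(1) by (simp add: h_def[symmetric] pos_divide_le_eq mult.commute)
qed

text \<open>At a fixed time all roots in one half plane undergo the same affine map; this is what
  allows the motion to be traded for a substitution in the variable.\<close>

definition contract_root :: "real \<Rightarrow> complex \<Rightarrow> complex" where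
  "contract_root t a = of_real (1 - t) * a + of_real (t * sgn (Im a)) * \<i>"

lemma Im_contract_root:
  assumes "0 \<le> t" "t \<le> 1"
  shows "Im a > 0 \<Longrightarrow> Im (contract_root t a) > 0" "Im a < 0 \<Longrightarrow> Im (contract_root t a) < 0"
proof -
  have im: "Im (contract_root t a) = (1 - t) * Im a + t * sgn (Im a)"
    by (simp add: contract_root_def)
  show "Im (contract_root t a) > 0" if "Im a > 0"
    using assms that unfolding im
    by (cases "t = 1") (auto intro!: add_pos_nonneg)
  show "Im (contract_root t a) < 0" if "Im a < 0"
    using assms that mult_pos_neg[of "1 - t" "Im a"] unfolding im
    by (cases "t = 1") auto
qed

lemma nonreal_contract:
  assumes "0 \<le> t" "t \<le> 1" "nonreal L"
  shows "nonreal (map (contract_root t) L)"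
  using assms Im_contract_root[OF assms(1,2)] unfolding nonreal_def
  by (metis (no_types, lifting) imageE linorder_neq_iff list.set_map)

text \<open>The motion preserves each half plane and commutes with conjugation, so it also commutes
  with reflecting lower roots.\<close>

lemma upper_roots_contract:
  assumes "0 \<le> t" "t \<le> 1" "nonreal L"
  shows "upper_roots (map (contract_root t) L) = map (contract_root t) (upper_roots L)"
    "lower_roots (map (contract_root t) L) = map (contract_root t) (lower_roots L)"
proof -
  have "(0 < Im (contract_root t a)) = (0 < Im a)" "(Im (contract_root t a) < 0) = (Im a < 0)"
    if "a \<in> set L" for a
    using that assms Im_contract_root[OF assms(1,2), of a] unfolding nonreal_def
    by (meson linorder_neqE_linordered_idom order_less_asym)+
  then show "upper_roots (map (contract_root t) L) = map (contract_root t) (upper_roots L)"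
    "lower_roots (map (contract_root t) L) = map (contract_root t) (lower_roots L)"
    unfolding upper_roots_def lower_roots_def
    by (auto simp: filter_map o_def contract_root_def sgn_minus cong: filter_cong)
qed

text \<open>Each factor satisfies \<open>z - contract_root t a = (1 - t) * ((z - t * \<i>) / (1 - t)
  - a)\<close>. For \<open>z\<close> in the closed lower half plane and
  \<open>0 \<le> t < 1\<close>, the substituted point stays there.\<close>

lemma root_prod_contract:
  assumes "t < 1" "\<forall>a\<in>set L. Im a > 0"
  shows "root_prod (map (contract_root t) L) z
    = of_real (1 - t) ^ length L * root_prod L ((z - of_real t * \<i>) / of_real (1 - t))"
  using assms(2)
proof (induction L)
  case (Cons a L)
  have "of_real (1 - t) \<noteq> (0::complex)" using assms(1) by (metis of_real_eq_0_iff diff_gt_0_iff_gt less_irrefl)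
  then have "z - contract_root t a = of_real (1 - t) * ((z - of_real t * \<i>) / of_real (1 - t) - a)"
    using Cons.prems by (simp add: contract_root_def right_diff_distrib nonzero_eq_divide_eq
        del: of_real_diff) (simp add: algebra_simps)
  with Cons show ?case by simp
qed simp

lemma root_prod_contract_1:
  assumes "\<forall>a\<in>set L. Im a > 0"
  shows "root_prod (map (contract_root 1) L) z = (z - \<i>) ^ length L"
  using assms by (induction L) (auto simp: contract_root_def)

theorem phase_contract_nonexpansive:
  assumes L: "nonreal L" and L': "nonreal L'"
    and len: "length (upper_roots L) = length (upper_roots L')"
      "length (lower_roots L) = length (lower_roots L')"
    and d: "d < 2" "\<And>x. norm (phase L' x - phase L x) \<le> d"
    and t: "0 \<le> t" "t \<le> 1"
  shows "norm (phase (map (contract_root t) L') x - phase (map (contract_root t) L) x) \<le> d"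
proof -
  let ?H = "{z. Im z \<le> 0}"
  define h where "h z = root_quot L' z / root_quot L z" for z
  have rq_nz: "root_quot M z \<noteq> 0" if "Im z \<le> 0" for M z
    using root_quot_upper_nz[OF that, of M] by (simp add: root_quot_def)
  have nz: "h z \<noteq> 0" if "Im z \<le> 0" for z
    using rq_nz[OF that] by (simp add: h_def)
  have hol': "root_quot M holomorphic_on ?H" for M
    unfolding root_quot_def [abs_def]
    by (intro holomorphic_intros holomorphic_root_prod) (use root_quot_upper_nz in auto)
  have hol: "h holomorphic_on ?H"
    unfolding h_def by (intro holomorphic_intros hol') (use rq_nz in auto)
  \<comment> \<open>All root products are normalised by their leading powers; the powers cancel in
    \<open>h\<close> because the counts in each half plane agree.\<close>
  have "((\<lambda>z. (root_prod (upper_roots L') z / z ^ length (upper_roots L')) /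
          (root_prod (lower_roots L') z / z ^ length (lower_roots L')) /
          ((root_prod (upper_roots L) z / z ^ length (upper_roots L)) /
          (root_prod (lower_roots L) z / z ^ length (lower_roots L)))) \<longlongrightarrow> 1 / 1 / (1 / 1)) at_infinity"
    by (intro tendsto_divide root_prod_asymp) auto
  moreover have "\<forall>\<^sub>F z in at_infinity. (root_prod (upper_roots L') z / z ^ length (upper_roots L')) /
          (root_prod (lower_roots L') z / z ^ length (lower_roots L')) /
          ((root_prod (upper_roots L) z / z ^ length (upper_roots L)) /
          (root_prod (lower_roots L) z / z ^ length (lower_roots L))) = h z"
    using eventually_not_equal_at_infinity[of 0]
    by eventually_elim (simp add: h_def root_quot_def len field_simps)
  ultimately have lim: "(h \<longlongrightarrow> 1) at_infinity"
    by (simp add: tendsto_cong)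
  have real: "\<bar>Im (h (of_real x))\<bar> \<le> d / 2 * norm (h (of_real x))" for x
    using d(2)[of x]
      norm_div_cnj_diff[of "root_quot L' (of_real x)" "root_quot L (of_real x)" d]
    unfolding phase_root_quot[OF L] phase_root_quot[OF L'] h_def by (simp add: rq_nz)
  have *: "\<bar>Im (h z)\<bar> \<le> d / 2 * norm (h z)" if "Im z \<le> 0" for z
  proof (rule sector_lower_half_plane [OF _ holomorphic_on_imp_continuous_on [OF hol] lim _ _ real that])
    show "h holomorphic_on {z. Im z < 0}"
      by (rule holomorphic_on_subset [OF hol]) auto
    show "h (of_real x) \<noteq> 0" for x
      by (rule nz) simp
    show "d / 2 < 1"
      using d(1) by simp
  qed
  have pos: "\<forall>a\<in>set (upper_roots M). Im a > 0" "\<forall>a\<in>set (lower_roots M). Im a > 0" for M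
    by (auto simp: upper_roots_def lower_roots_def)
  \<comment> \<open>The prefactor depends only on the two counts, so it drops out of the quotient
    for \<open>L'\<close> and \<open>L\<close>.\<close>
  have rq: "root_quot (map (contract_root t) M) z = of_real (1 - t) ^ length (upper_roots M) /
      of_real (1 - t) ^ length (lower_roots M) * root_quot M ((z - of_real t * \<i>) / of_real (1 - t))"
    if "t < 1" "nonreal M" for M z
    using that by (simp add: root_quot_def upper_roots_contract[OF t] root_prod_contract pos)
  have "\<bar>Im (u / v)\<bar> \<le> d / 2 * norm (u / v)"
    if u: "u = root_quot (map (contract_root t) L') (of_real x)"
      and v: "v = root_quot (map (contract_root t) L) (of_real x)" for u v
  proof (cases "t < 1")
    case True
    let ?z = "(of_real x - of_real t * \<i>) / of_real (1 - t) :: complex"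
    have "of_real (1 - t) \<noteq> (0::complex)"
      using True by (metis of_real_eq_0_iff diff_gt_0_iff_gt less_irrefl)
    then have "u / v = h ?z"
      by (simp add: u v rq[OF True] L L' len h_def)
    moreover have "Im ?z \<le> 0"
      using t True by (simp only: Im_divide_of_real) (simp add: field_simps)
    ultimately show ?thesis using * by simp
  next
    case False
    \<comment> \<open>The substitution degenerates at the end time; there all roots sit at
      \<open>\<i>\<close> or \<open>- \<i>\<close>, and equal counts make the two quotients
      equal.\<close>
    then have [simp]: "t = 1" using t by simp
    have "u = v"
      unfolding u v root_quot_def
      using upper_roots_contract[OF t L] upper_roots_contract[OF t L']
      by (simp add: root_prod_contract_1 pos len)
    moreover have "0 \<le> d"
      using d(2)[of 0] norm_ge_zero order.trans by blast
    ultimately show ?thesis by simp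
  qed
  then show ?thesis
    unfolding phase_root_quot[OF nonreal_contract[OF t L]] phase_root_quot[OF nonreal_contract[OF t L']]
    by (subst norm_div_cnj_diff) (simp_all add: rq_nz)
qed

subsection \<open>Loops in the projective line as loops in the unit circle\<close>

declare One_nat_def [simp del]

definition vec_of :: "complex \<Rightarrow> nat \<Rightarrow> real" where
  "vec_of z = (\<lambda>i. if i = 0 then Re z else if i = 1 then Im z else 0)"

definition RP1_point :: "complex \<Rightarrow> (nat \<Rightarrow> real) set" where
  "RP1_point z = proj_class (vec_of z)"

text \<open>On the line spanned by \<open>z\<close> the value is \<open>z / cnj z\<close>. This
  embeds the projective line in the plane as the unit circle, and distances between loops are
  measured in it.\<close>

definition RP1_coord :: "(nat \<Rightarrow> real) set \<Rightarrow> complex" where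
  "RP1_coord L = plane_point (RP1_to_circle L)"

lemma plane_point_vec_of [simp]: "plane_point (vec_of z) = z"
  by (simp add: plane_point_def vec_of_def)

lemma vec_of_plane_point:
  assumes "\<And>i. i \<ge> 2 \<Longrightarrow> v i = 0"
  shows "vec_of (plane_point v) = v"
  using assms by (auto simp: vec_of_def plane_point_def fun_eq_iff)

lemma vec_of_eq_0_iff [simp]: "vec_of z = (\<lambda>i. 0) \<longleftrightarrow> z = 0"
proof
  assume "vec_of z = (\<lambda>i. 0)"
  then have "plane_point (vec_of z) = plane_point (\<lambda>i. 0)" by simp
  then show "z = 0" by (simp only: plane_point_vec_of) (simp add: plane_point_def complex_eq_iff)
qed (simp add: vec_of_def fun_eq_iff)

lemma vec_of_ge_2 [simp]: "i \<ge> 2 \<Longrightarrow> vec_of z i = 0"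
  by (simp add: vec_of_def)

lemma continuous_map_vec_of: "continuous_map (top_of_set S) (powertop_real UNIV) vec_of"
proof -
  have "continuous_on UNIV (\<lambda>z. vec_of z i)" for i
    by (cases "i = 0"; cases "i = 1") (auto simp: vec_of_def intro!: continuous_intros)
  then show ?thesis
    unfolding continuous_map_componentwise_UNIV
    by (metis UNIV_I continuous_map_iff_continuous continuous_on_subset subset_UNIV)
qed

lemma vec_of_in_nsphere: "norm z = 1 \<Longrightarrow> vec_of z \<in> topspace (nsphere 1)"
  by (auto simp: nsphere vec_of_def cmod_def One_nat_def)

lemma circle_point_eq_vec_of: "circle_point t = vec_of (exp (2 * of_real pi * \<i> * of_real t))"
  by (auto simp: circle_point_def vec_of_def fun_eq_iff Re_exp Im_exp)

lemma topspace_RP1: "topspace (RP 1) = RP1_point ` (- {0})"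
proof -
  have "topspace (subtopology (Euclidean_space (Suc 1)) (- {\<lambda>i. 0})) = vec_of ` (- {0})"
  proof (intro equalityI subsetI)
    fix v assume v: "v \<in> topspace (subtopology (Euclidean_space (Suc 1)) (- {\<lambda>i. 0}))"
    then have "vec_of (plane_point v) = v"
      by (intro vec_of_plane_point) (auto simp: topspace_Euclidean_space)
    moreover have "plane_point v \<noteq> 0"
      using v \<open>vec_of (plane_point v) = v\<close> vec_of_eq_0_iff by fastforce
    ultimately show "v \<in> vec_of ` (- {0})"
      by (metis ComplI image_eqI singletonD)
  next
    fix v assume "v \<in> vec_of ` (- {0})"
    then show "v \<in> topspace (subtopology (Euclidean_space (Suc 1)) (- {\<lambda>i. 0}))"
      by (auto simp: topspace_Euclidean_space)
  qed
  then show ?thesis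
    by (auto simp: RP_def RP1_point_def)
qed

text \<open>The doubling formula is homogeneous of degree 0, so the image of a class is a singleton
  and \<open>the_elem\<close> is meaningful.\<close>

lemma RP1_to_circle_proj_class: "RP1_to_circle (proj_class v) = double_angle v"
proof -
  have "double_angle (\<lambda>i. c * v i) = double_angle v" if "c \<noteq> 0" for c
  proof -
    have "(c * a)\<^sup>2 - (c * b)\<^sup>2 = c\<^sup>2 * (a\<^sup>2 - b\<^sup>2)" "(c * a)\<^sup>2 + (c * b)\<^sup>2 = c\<^sup>2 * (a\<^sup>2 + b\<^sup>2)"
      "2 * (c * a) * (c * b) = c\<^sup>2 * (2 * a * b)" for a b
      by (simp_all add: algebra_simps power2_eq_square)
    then show ?thesis
      using that unfolding double_angle_def
      by (simp only: mult_divide_mult_cancel_left[of "c\<^sup>2"] power_eq_0_iff simp_thms not_False_eq_True)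
  qed
  then have "double_angle ` proj_class v = {double_angle v}"
    by (force simp: proj_class_def image_iff intro: exI[of _ 1])
  then show ?thesis
    by (simp add: RP1_to_circle_def)
qed

lemma double_angle_vec_of: "double_angle (vec_of z) = vec_of (z / cnj z)"
  by (auto simp: double_angle_def vec_of_def fun_eq_iff Re_divide Im_divide power2_eq_square algebra_simps)

lemma RP1_to_circle_point: "RP1_to_circle (RP1_point z) = vec_of (z / cnj z)"
  by (simp add: RP1_point_def RP1_to_circle_proj_class double_angle_vec_of)

lemma RP1_coord_point [simp]: "RP1_coord (RP1_point z) = z / cnj z"
  by (simp add: RP1_coord_def RP1_to_circle_point)

lemma RP1_to_circle_eq: "L \<in> topspace (RP 1) \<Longrightarrow> RP1_to_circle L = vec_of (RP1_coord L)"
  by (auto simp: topspace_RP1 RP1_to_circle_point)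

lemma RP1_point_scale: "c \<noteq> 0 \<Longrightarrow> RP1_point (of_real c * z) = RP1_point z"
proof -
  assume c: "c \<noteq> 0"
  have "vec_of (of_real c * z) = (\<lambda>i. c * vec_of z i)"
    by (auto simp: vec_of_def)
  moreover have "proj_class (\<lambda>i. c * v i) = proj_class v" for v
  proof (intro equalityI subsetI)
    fix u assume "u \<in> proj_class (\<lambda>i. c * v i)"
    then obtain d where "d \<noteq> 0" "u = (\<lambda>i. d * (c * v i))" by (auto simp: proj_class_def)
    then show "u \<in> proj_class v"
      using c unfolding proj_class_def by (auto intro!: exI[of _ "d * c"])
  next
    fix u assume "u \<in> proj_class v"
    then obtain d where "d \<noteq> 0" "u = (\<lambda>i. d * v i)" by (auto simp: proj_class_def)
    then show "u \<in> proj_class (\<lambda>i. c * v i)"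
      using c unfolding proj_class_def by (auto intro!: exI[of _ "d / c"])
  qed
  ultimately show ?thesis
    by (simp add: RP1_point_def)
qed

text \<open>Equal coordinates say that \<open>u / v\<close> equals its own conjugate, so
  \<open>u\<close> and \<open>v\<close> differ by a real scalar.\<close>

lemma inj_RP1_coord: "inj_on RP1_coord (topspace (RP 1))"
proof (rule inj_onI)
  fix K L assume "K \<in> topspace (RP 1)" "L \<in> topspace (RP 1)" and eq: "RP1_coord K = RP1_coord L"
  then obtain u v where uv: "u \<noteq> 0" "v \<noteq> 0" "K = RP1_point u" "L = RP1_point v"
    by (auto simp: topspace_RP1)
  define q where "q = u / v"
  have "u * cnj v = v * cnj u"
    using eq uv by (simp add: field_simps)
  then have "cnj q = q"
    using uv(1,2) by (simp add: q_def field_simps)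
  then have "q = of_real (Re q)"
    by (simp add: complex_eq_iff)
  then have "u = of_real (Re q) * v" "Re q \<noteq> 0"
    using uv(1,2) by (auto simp: q_def field_simps)
  then show "K = L"
    using uv RP1_point_scale[of "Re q" v] by simp
qed

lemma quotient_map_RP1:
  "quotient_map (subtopology (Euclidean_space (Suc 1)) (- {\<lambda>i. 0})) (RP 1) proj_class"
  unfolding RP_def by (rule quotient_map_quotient_topology)

lemma continuous_map_RP1_point: "continuous_map (top_of_set (- {0})) (RP 1) RP1_point"
proof -
  have "continuous_map (top_of_set (- {0})) (subtopology (Euclidean_space (Suc 1)) (- {\<lambda>i. 0})) vec_of"
    by (auto simp: Euclidean_space_def subtopology_subtopology continuous_map_in_subtopology
        continuous_map_vec_of)
  then have "continuous_map (top_of_set (- {0})) (RP 1) (proj_class \<circ> vec_of)"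
    using quotient_imp_continuous_map[OF quotient_map_RP1] by (rule continuous_map_compose)
  then show ?thesis
    by (simp add: RP1_point_def [abs_def] o_def)
qed

lemma topspace_RP1_sphere: "topspace (RP 1) = RP1_point ` sphere 0 1"
proof -
  have "RP1_point z \<in> RP1_point ` sphere 0 1" if "z \<noteq> 0" for z
    using that RP1_point_scale[of "inverse (norm z)" z]
    by (intro image_eqI[of _ _ "of_real (inverse (norm z)) * z"]) (auto simp: norm_mult norm_inverse)
  then show ?thesis
    by (auto simp: topspace_RP1)
qed

lemma compact_space_RP1: "compact_space (RP 1)"
proof -
  have "continuous_map (top_of_set (sphere 0 1)) (RP 1) RP1_point"
    using continuous_map_from_subtopology_mono[OF continuous_map_RP1_point, of "sphere 0 1"] by auto
  then have "compactin (RP 1) (RP1_point ` sphere 0 1)"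
    by (rule image_compactin[rotated]) (simp add: compactin_subtopology)
  then show ?thesis
    by (simp add: compact_space_def topspace_RP1_sphere)
qed

lemma continuous_map_RP1_to_circle: "continuous_map (RP 1) (nsphere 1) RP1_to_circle"
proof (rule continuous_compose_quotient_map [OF quotient_map_RP1])
  let ?X = "subtopology (Euclidean_space (Suc 1)) (- {\<lambda>i. 0})"
  have c: "continuous_map ?X euclideanreal (\<lambda>v. v i)" for i
    unfolding Euclidean_space_def
    by (intro continuous_map_from_subtopology continuous_map_product_projection) simp
  have vec: "vec_of (plane_point v) = v" "plane_point v \<noteq> 0" if v: "v \<in> topspace ?X" for v
  proof -
    show *: "vec_of (plane_point v) = v"
      using v by (intro vec_of_plane_point) (auto simp: topspace_Euclidean_space)
    show "plane_point v \<noteq> 0"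
      using v * vec_of_eq_0_iff by fastforce
  qed
  have "continuous_map ?X euclidean plane_point"
    by (intro continuous_map_plane_point c)
  then have "continuous_map ?X (top_of_set (- {0})) plane_point"
    using vec(2) by (auto simp: continuous_map_in_subtopology)
  moreover have "continuous_map (top_of_set (- {0})) (top_of_set (sphere 0 1)) (\<lambda>z. z / cnj z)"
    by (auto simp: continuous_map_in_subtopology norm_divide intro!: continuous_intros)
  moreover have "continuous_map (top_of_set (sphere 0 1)) (nsphere 1) vec_of"
    using vec_of_in_nsphere by (auto simp: nsphere continuous_map_in_subtopology continuous_map_vec_of)
  ultimately have "continuous_map ?X (nsphere 1) (vec_of \<circ> ((\<lambda>z. z / cnj z) \<circ> plane_point))"
    by (intro continuous_map_compose)
  then show "continuous_map ?X (nsphere 1) (RP1_to_circle \<circ> proj_class)"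
    by (rule continuous_map_eq)
      (use vec(1) in \<open>auto simp: RP1_to_circle_proj_class simp flip: double_angle_vec_of\<close>)
qed

lemma continuous_map_RP1_coord: "continuous_map (RP 1) euclidean RP1_coord"
  using continuous_map_compose[OF continuous_map_RP1_to_circle continuous_map_plane_point_nsphere]
  by (simp add: RP1_coord_def [abs_def] o_def)

lemma embedding_map_RP1_coord: "embedding_map (RP 1) euclidean RP1_coord"
  by (intro continuous_imp_embedding_map continuous_map_RP1_coord compact_space_RP1
      Hausdorff_space_euclidean inj_RP1_coord)

definition RP1_inv :: "complex \<Rightarrow> (nat \<Rightarrow> real) set" where
  "RP1_inv w = RP1_point (csqrt w)"

lemma norm_RP1_coord: "L \<in> topspace (RP 1) \<Longrightarrow> norm (RP1_coord L) = 1"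
  by (auto simp: topspace_RP1 norm_divide split: if_splits)

lemma RP1_inv_in [simp]: "norm w = 1 \<Longrightarrow> RP1_inv w \<in> topspace (RP 1)"
  by (auto simp: topspace_RP1 RP1_inv_def)

lemma RP1_coord_inv [simp]: "norm w = 1 \<Longrightarrow> RP1_coord (RP1_inv w) = w"
proof -
  assume "norm w = 1"
  then have "csqrt w * cnj (csqrt w) = 1" "csqrt w \<noteq> 0"
    by (auto simp flip: complex_norm_square)
  then have "csqrt w / cnj (csqrt w) = (csqrt w)\<^sup>2"
    by (simp add: power2_eq_square field_simps)
  then show ?thesis
    by (simp add: RP1_inv_def)
qed

lemma RP1_inv_coord [simp]: "L \<in> topspace (RP 1) \<Longrightarrow> RP1_inv (RP1_coord L) = L"
  by (meson RP1_coord_inv RP1_inv_in inj_RP1_coord inj_onD norm_RP1_coord)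

lemma RP1_infinity_point: "RP1_infinity = RP1_point 1"
  unfolding RP1_infinity_def homog_def RP1_point_def
  by (rule arg_cong[of _ _ proj_class]) (auto simp: vec_of_def fun_eq_iff)

lemma homog_1_point: "homog 1 v = RP1_point (Complex (v 0) (v 1))"
  unfolding homog_def RP1_point_def
  by (rule arg_cong[of _ _ proj_class]) (auto simp: vec_of_def fun_eq_iff le_Suc_eq)

text \<open>The branch \<open>csqrt\<close> jumps across the negative axis, but only by a sign,
  which the projective class absorbs. Continuity is obtained by identifying the map with the inverse
  of the homeomorphism \<open>RP1_coord\<close>.\<close>

lemma continuous_map_RP1_inv: "continuous_map (top_of_set (sphere 0 1)) (RP 1) RP1_inv"
proof -
  have "homeomorphic_map (RP 1) (top_of_set (RP1_coord ` topspace (RP 1))) RP1_coord"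
    using embedding_map_RP1_coord by (simp add: embedding_map_def)
  moreover have "RP1_coord ` topspace (RP 1) = sphere 0 1"
  proof (intro equalityI subsetI)
    fix w :: complex assume "w \<in> sphere 0 1"
    then show "w \<in> RP1_coord ` topspace (RP 1)"
      using RP1_coord_inv[of w] RP1_inv_in[of w] by (intro image_eqI[of _ _ "RP1_inv w"]) auto
  qed (use norm_RP1_coord in auto)
  ultimately obtain g where g: "homeomorphic_maps (RP 1) (top_of_set (sphere 0 1)) RP1_coord g"
    by (auto simp: homeomorphic_map_maps)
  then have "g w = RP1_inv w" if "w \<in> sphere 0 1" for w
    using that by (metis RP1_coord_inv RP1_inv_coord RP1_inv_in homeomorphic_maps_def mem_sphere_0
        topspace_euclidean_subtopology)
  moreover have "continuous_map (top_of_set (sphere 0 1)) (RP 1) g"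
    using g by (simp add: homeomorphic_maps_def)
  ultimately show ?thesis
    by (rule continuous_map_eq[rotated]) auto
qed

section \<open>Based loops as self-maps of the circle that fix 1\<close>

abbreviation loops :: "((nat \<Rightarrow> real) set \<Rightarrow> (nat \<Rightarrow> real) set) set" where
  "loops \<equiv> topspace (loop_RP 1)"

text \<open>The base point \<open>[1 : 1]\<close> has coordinate \<open>\<i>\<close>; the factor \<open>- \<i>\<close> moves it to \<open>1\<close>.\<close>

definition loop_coord :: "((nat \<Rightarrow> real) set \<Rightarrow> (nat \<Rightarrow> real) set) \<Rightarrow> complex \<Rightarrow> complex" where
  "loop_coord f w = - \<i> * RP1_coord (f (RP1_inv w))"

lemma loops_iff: "f \<in> loops \<longleftrightarrow> f \<in> continuous_maps (RP 1) (RP 1) \<and> f RP1_infinity = base_pt 1"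
  by (auto simp: loop_RP_def)

lemma base_pt_point: "base_pt 1 = RP1_point (Complex 1 1)"
  by (simp add: base_pt_def homog_1_point)

lemma RP1_inv_1: "RP1_inv 1 = RP1_infinity"
  by (simp add: RP1_inv_def RP1_infinity_point)

lemma RP1_coord_base_pt: "RP1_coord (base_pt 1) = \<i>"
  by (simp add: base_pt_point complex_eq_iff Re_divide Im_divide)

lemma loop_in: "f \<in> loops \<Longrightarrow> L \<in> topspace (RP 1) \<Longrightarrow> f L \<in> topspace (RP 1)"
  by (auto simp: loops_iff continuous_maps_def continuous_map_def)

lemma norm_loop_coord: "f \<in> loops \<Longrightarrow> norm w = 1 \<Longrightarrow> norm (loop_coord f w) = 1"
  by (simp add: loop_coord_def norm_mult norm_RP1_coord loop_in)

lemma loop_coord_1: "f \<in> loops \<Longrightarrow> loop_coord f 1 = 1"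
  by (simp add: loop_coord_def RP1_inv_1 loops_iff RP1_coord_base_pt)

lemma continuous_on_loop_coord:
  assumes "f \<in> loops"
  shows "continuous_on (sphere 0 1) (loop_coord f)"
proof -
  have "continuous_map (RP 1) (RP 1) f"
    using assms by (simp add: loops_iff continuous_maps_def)
  then have "continuous_map (top_of_set (sphere 0 1)) euclidean (RP1_coord \<circ> (f \<circ> RP1_inv))"
    by (intro continuous_map_compose[OF _ continuous_map_RP1_coord]
        continuous_map_compose[OF continuous_map_RP1_inv])
  then have "continuous_on (sphere 0 1) (\<lambda>w. RP1_coord (f (RP1_inv w)))"
    by (simp add: o_def)
  then show ?thesis
    unfolding loop_coord_def by (intro continuous_intros)
qed

lemma loop_coord_inject:
  assumes "f \<in> loops" "g \<in> loops" "\<And>w. norm w = 1 \<Longrightarrow> loop_coord f w = loop_coord g w"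
  shows "f = g"
proof (rule extensionalityI)
  show "f \<in> extensional (topspace (RP 1))" "g \<in> extensional (topspace (RP 1))"
    using assms by (auto simp: loops_iff continuous_maps_def)
  fix L assume L: "L \<in> topspace (RP 1)"
  then have "RP1_coord (f L) = RP1_coord (g L)"
    using assms(3)[of "RP1_coord L"] by (simp add: loop_coord_def norm_RP1_coord)
  then show "f L = g L"
    using inj_RP1_coord loop_in[OF assms(1) L] loop_in[OF assms(2) L] by (auto simp: inj_on_def)
qed

lemma loop_coord_surj:
  assumes "continuous_on (sphere 0 1) g" "\<And>w. norm w = 1 \<Longrightarrow> norm (g w) = 1" "g 1 = 1"
  obtains f where "f \<in> loops" "\<And>w. norm w = 1 \<Longrightarrow> loop_coord f w = g w"
proof
  define f where "f = restrict (\<lambda>L. RP1_inv (\<i> * g (RP1_coord L))) (topspace (RP 1))"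
  have nrm: "norm (\<i> * g w) = 1" if "norm w = 1" for w
    using assms(2)[OF that] by (simp add: norm_mult)
  have "continuous_map (RP 1) (top_of_set (sphere 0 1)) RP1_coord"
    using continuous_map_RP1_coord norm_RP1_coord by (auto simp: continuous_map_in_subtopology)
  moreover have "continuous_map (top_of_set (sphere 0 1)) (top_of_set (sphere 0 1)) (\<lambda>w. \<i> * g w)"
    using assms(1) nrm by (auto simp: continuous_map_in_subtopology intro!: continuous_intros)
  ultimately have "continuous_map (RP 1) (RP 1) (RP1_inv \<circ> ((\<lambda>w. \<i> * g w) \<circ> RP1_coord))"
    by (intro continuous_map_compose[OF _ continuous_map_RP1_inv] continuous_map_compose)
  then have "continuous_map (RP 1) (RP 1) f"
    by (rule continuous_map_eq) (auto simp: f_def)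
  moreover have "f RP1_infinity = base_pt 1"
  proof -
    have "RP1_infinity \<in> topspace (RP 1)" "RP1_coord RP1_infinity = 1"
      using RP1_inv_in[of 1] RP1_coord_inv[of 1] by (simp_all add: RP1_inv_1)
    then have "f RP1_infinity = RP1_inv \<i>"
      using assms(3) by (simp add: f_def)
    also have "\<dots> = base_pt 1"
      using RP1_inv_coord[of "base_pt 1"]
      by (simp add: RP1_coord_base_pt) (simp add: base_pt_point topspace_RP1 complex_eq_iff)
    finally show ?thesis .
  qed
  ultimately show "f \<in> loops"
    by (auto simp: loops_iff continuous_maps_def f_def)
  fix w :: complex assume "norm w = 1"
  then show "loop_coord f w = g w"
    using nrm by (simp add: loop_coord_def f_def)
qed

theorem openin_loop_RP_iff:
  "openin (loop_RP 1) U \<longleftrightarrow> U \<subseteq> loops \<and>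
    (\<forall>f\<in>U. \<exists>\<epsilon>>0. \<forall>g\<in>loops.
       (\<forall>w. norm w = 1 \<longrightarrow> dist (loop_coord g w) (loop_coord f w) < \<epsilon>) \<longrightarrow> g \<in> U)"
    (is "_ \<longleftrightarrow> ?rhs")
proof -
  define near where "near \<epsilon> f g \<longleftrightarrow>
    (\<forall>L\<in>topspace (RP 1). dist (RP1_coord (g L)) (RP1_coord (f L)) < \<epsilon>)"
    for \<epsilon> :: real and f g :: "(nat \<Rightarrow> real) set \<Rightarrow> (nat \<Rightarrow> real) set"
  have d: "(\<forall>w. norm w = 1 \<longrightarrow> dist (loop_coord g w) (loop_coord f w) < \<epsilon>) \<longleftrightarrow> near \<epsilon> f g" for f g \<epsilon>
  proof -
    have "dist (loop_coord g w) (loop_coord f w)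
        = dist (RP1_coord (g (RP1_inv w))) (RP1_coord (f (RP1_inv w)))" for w
      by (simp add: loop_coord_def dist_norm norm_mult norm_minus_commute flip: right_diff_distrib)
    moreover have "topspace (RP 1) = RP1_inv ` {w. norm w = 1}"
      using RP1_inv_coord norm_RP1_coord RP1_inv_in by (force simp: image_iff)
    ultimately show ?thesis
      by (simp add: near_def)
  qed
  have near_refl: "near \<epsilon> f f" if "\<epsilon> > 0" for \<epsilon> f
    using that by (simp add: near_def)
  have near_half: "near \<epsilon> f h" if "near (\<epsilon>/2) f g" "near (\<epsilon>/2) g h" for \<epsilon> f g h
    unfolding near_def
  proof
    fix L assume "L \<in> topspace (RP 1)"
    then show "dist (RP1_coord (h L)) (RP1_coord (f L)) < \<epsilon>"
      using that dist_triangle[of "RP1_coord (h L)" "RP1_coord (f L)" "RP1_coord (g L)"]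
      by (fastforce simp: near_def)
  qed
  note co = openin_compact_open_topology_iff
    [OF compact_space_RP1 embedding_map_RP1_coord, folded near_def]
  show ?thesis
    unfolding d
  proof (intro iffI conjI ballI)
    assume o: "openin (loop_RP 1) U"
    then show "U \<subseteq> loops" by (rule openin_subset)
    obtain T where T: "openin (compact_open_topology (RP 1) (RP 1)) T"
      "U = T \<inter> {f. f RP1_infinity = base_pt 1}"
      using o unfolding loop_RP_def openin_subtopology by blast
    show "\<exists>\<epsilon>>0. \<forall>g\<in>loops. near \<epsilon> f g \<longrightarrow> g \<in> U" if f: "f \<in> U" for f
    proof -
      have "f \<in> T" using f T(2) by blast
      then obtain \<epsilon> where "\<epsilon> > 0" "\<forall>g\<in>continuous_maps (RP 1) (RP 1). near \<epsilon> f g \<longrightarrow> g \<in> T"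
        using T(1) unfolding co by blast
      then have "\<forall>g\<in>loops. near \<epsilon> f g \<longrightarrow> g \<in> U"
        unfolding T(2) by (auto simp only: loops_iff)
      with \<open>\<epsilon> > 0\<close> show ?thesis by blast
    qed
  next
    assume R: "U \<subseteq> loops \<and> (\<forall>f\<in>U. \<exists>\<epsilon>>0. \<forall>g\<in>loops. near \<epsilon> f g \<longrightarrow> g \<in> U)"
    \<comment> \<open>An open set of maps, based or not, whose trace on the based loops is
      \<open>U\<close>: the maps with a ball whose based members all lie in \<open>U\<close>.
      Halving the radius shows that it is open.\<close>
    define T where "T = {f \<in> continuous_maps (RP 1) (RP 1). \<exists>\<epsilon>>0. \<forall>g\<in>loops. near \<epsilon> f g \<longrightarrow> g \<in> U}"
    have "openin (compact_open_topology (RP 1) (RP 1)) T"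
      unfolding co
    proof (intro conjI ballI)
      show "T \<subseteq> continuous_maps (RP 1) (RP 1)" unfolding T_def by blast
      fix f assume "f \<in> T"
      then obtain \<epsilon> where \<epsilon>: "\<epsilon> > 0" "\<forall>g\<in>loops. near \<epsilon> f g \<longrightarrow> g \<in> U"
        unfolding T_def by blast
      have "g \<in> T" if g: "g \<in> continuous_maps (RP 1) (RP 1)" "near (\<epsilon>/2) f g" for g
      proof -
        have "\<forall>h\<in>loops. near (\<epsilon>/2) g h \<longrightarrow> h \<in> U"
          using near_half[OF g(2)] \<epsilon>(2) by blast
        then show ?thesis
          unfolding T_def using \<epsilon>(1) g(1) by (intro CollectI conjI exI[of _ "\<epsilon>/2"]) simp_all
      qed
      then show "\<exists>\<epsilon>>0. \<forall>g\<in>continuous_maps (RP 1) (RP 1). near \<epsilon> f g \<longrightarrow> g \<in> T"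
        using half_gt_zero[OF \<epsilon>(1)] by blast
    qed
    moreover have "U = T \<inter> {f. f RP1_infinity = base_pt 1}"
    proof
      show "U \<subseteq> T \<inter> {f. f RP1_infinity = base_pt 1}"
      proof
        fix f assume "f \<in> U"
        moreover from this have "f \<in> loops" using R by blast
        ultimately show "f \<in> T \<inter> {f. f RP1_infinity = base_pt 1}"
          using R by (simp add: T_def loops_iff)
      qed
      show "T \<inter> {f. f RP1_infinity = base_pt 1} \<subseteq> U"
      proof
        fix f assume f: "f \<in> T \<inter> {f. f RP1_infinity = base_pt 1}"
        then obtain \<epsilon> where "\<epsilon> > 0" "\<forall>g\<in>loops. near \<epsilon> f g \<longrightarrow> g \<in> U"
          unfolding T_def by blast
        moreover have "f \<in> loops"
          using f by (simp add: T_def loops_iff)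
        ultimately show "f \<in> U" using near_refl by blast
      qed
    qed
    ultimately show "openin (loop_RP 1) U"
      unfolding loop_RP_def openin_subtopology by blast
  qed
qed

section \<open>The degree of a based loop\<close>

lemma winding_number_cmult:
  assumes "path p" "0 \<notin> path_image p" "c \<noteq> 0"
  shows "winding_number (\<lambda>t. c * p t) 0 = winding_number p 0"
proof -
  obtain q where q: "path q" "pathfinish q - pathstart q = 2 * of_real pi * \<i> * winding_number p 0"
      "\<And>t. t \<in> {0..1} \<Longrightarrow> p t = 0 + exp (q t)"
    using winding_number_as_continuous_log [OF assms(1,2)] by blast
  have "2 * of_real pi * \<i> * winding_number (\<lambda>t. c * p t) 0 = (q 1 + Ln c) - (q 0 + Ln c)"
  proof (rule winding_number_continuous_log)
    show "path (\<lambda>t. c * p t)"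
      using assms(1) by (auto simp: path_def intro!: continuous_intros)
    show "0 \<notin> path_image (\<lambda>t. c * p t)"
      using assms(2,3) by (auto simp: path_image_def)
    show "continuous_on {0..1} (\<lambda>t. q t + Ln c)"
      using q(1) by (auto simp: path_def intro!: continuous_intros)
    show "c * p t = 0 + exp (q t + Ln c)" if "t \<in> {0..1}" for t
      using q(3)[OF that] assms(3) by (simp add: exp_add)
  qed
  with q(2) show ?thesis
    by (simp add: pathfinish_def pathstart_def)
qed

definition circle_loop :: "(complex \<Rightarrow> complex) \<Rightarrow> real \<Rightarrow> complex" where
  "circle_loop g t = g (exp (2 * of_real pi * \<i> * of_real t))"

lemma norm_exp_circle [simp]: "norm (exp (2 * of_real pi * \<i> * of_real t)) = 1"
  by (simp add: norm_exp_eq_Re)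

lemma path_circle_loop: "continuous_on (sphere 0 1) g \<Longrightarrow> path (circle_loop g)"
  unfolding path_def circle_loop_def
  by (rule continuous_on_compose2[of "sphere 0 1" g]) (auto intro!: continuous_intros)

lemma circle_loop_nz: "(\<And>w. norm w = 1 \<Longrightarrow> g w \<noteq> 0) \<Longrightarrow> 0 \<notin> path_image (circle_loop g)"
  by (auto simp: path_image_def circle_loop_def)

text \<open>In the circle coordinates on both sides the loop becomes \<open>\<i>\<close> times
  \<open>loop_coord f\<close>, and the constant factor leaves the winding number unchanged.\<close>

theorem RP1_degree_winding_number:
  assumes f: "f \<in> loops"
  shows "of_int (RP1_degree f) = winding_number (circle_loop (loop_coord f)) 0"
proof -
  let ?inv = "inv_into (topspace (RP 1)) RP1_to_circle"
  have inv: "?inv (vec_of w) = RP1_inv w" if "norm w = 1" for w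
  proof -
    have "inj_on RP1_to_circle (topspace (RP 1))"
      using inj_RP1_coord by (auto simp: inj_on_def RP1_coord_def)
    moreover have "RP1_to_circle (RP1_inv w) = vec_of w"
      using that by (simp add: RP1_to_circle_eq)
    ultimately show ?thesis
      using that by (metis RP1_inv_in inv_into_f_f)
  qed
  have vec: "vec_of (plane_point v) = v" "norm (plane_point v) = 1" if "v \<in> topspace (nsphere 1)" for v
  proof -
    show "vec_of (plane_point v) = v"
      using that by (intro vec_of_plane_point) (auto simp: nsphere)
    show "norm (plane_point v) = 1"
      using that by (auto simp: nsphere plane_point_def cmod_def One_nat_def)
  qed
  have "continuous_map (nsphere 1) (top_of_set (sphere 0 1)) plane_point"
    using continuous_map_plane_point_nsphere vec(2) by (auto simp: continuous_map_in_subtopology)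
  then have "continuous_map (nsphere 1) (RP 1) (RP1_inv \<circ> plane_point)"
    using continuous_map_RP1_inv by (rule continuous_map_compose)
  then have "continuous_map (nsphere 1) (RP 1) ?inv"
    by (rule continuous_map_eq) (use inv vec in \<open>metis o_apply\<close>)
  moreover have "continuous_map (RP 1) (RP 1) f"
    using f by (simp add: loops_iff continuous_maps_def)
  ultimately have "continuous_map (nsphere 1) (nsphere 1) (RP1_to_circle \<circ> f \<circ> ?inv)"
    using continuous_map_RP1_to_circle by (intro continuous_map_compose)
  then have "of_int (RP1_degree f)
      = winding_number (\<lambda>t. plane_point ((RP1_to_circle \<circ> f \<circ> ?inv) (circle_point t))) 0"
    unfolding RP1_degree_def by (rule Brouwer_degree2_winding_number)
  also have "(\<lambda>t. plane_point ((RP1_to_circle \<circ> f \<circ> ?inv) (circle_point t)))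
      = (\<lambda>t. \<i> * circle_loop (loop_coord f) t)"
    by (simp add: circle_point_eq_vec_of inv circle_loop_def loop_coord_def RP1_coord_def fun_eq_iff)
  also have "winding_number \<dots> 0 = winding_number (circle_loop (loop_coord f)) 0"
  proof (rule winding_number_cmult)
    show "path (circle_loop (loop_coord f))"
      by (rule path_circle_loop [OF continuous_on_loop_coord [OF f]])
    show "0 \<notin> path_image (circle_loop (loop_coord f))"
      using norm_loop_coord[OF f] by (intro circle_loop_nz) force
  qed simp
  finally show ?thesis .
qed

subsection \<open>Loops with prescribed roots\<close>

text \<open>This is \<open>(x - a) / (x - cnj a)\<close> in the coordinate \<open>w = (x + \<i>) / (x - \<i>)\<close> of the circle.\<close>

definition blaschke :: "complex \<Rightarrow> complex \<Rightarrow> complex" where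
  "blaschke a w = (w * (\<i> - a) + (\<i> + a)) / (w * (\<i> - cnj a) + (\<i> + cnj a))"

definition blaschke_list :: "complex list \<Rightarrow> complex \<Rightarrow> complex" where
  "blaschke_list L w = (\<Prod>a\<leftarrow>L. blaschke a w)"

text \<open>The circle coordinate of the affine point \<open>x\<close>. The only point of the circle
  that it misses is 1, the coordinate of infinity.\<close>

definition cayley :: "real \<Rightarrow> complex" where
  "cayley x = (of_real x + \<i>) / (of_real x - \<i>)"

lemma blaschke_list_simps [simp]:
  "blaschke_list [] w = 1" "blaschke_list (a # L) w = blaschke a w * blaschke_list L w"
  by (simp_all add: blaschke_list_def)

lemma blaschke_list_append: "blaschke_list (L @ M) w = blaschke_list L w * blaschke_list M w"
  by (simp add: blaschke_list_def)

text \<open>A zero on the unit circle would make \<open>a\<close> equidistant from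
  \<open>\<i>\<close> and \<open>- \<i>\<close>, hence real.\<close>

lemma blaschke_denom_nz:
  assumes "norm w = 1" "Im a \<noteq> 0"
  shows "w * (\<i> - a) + (\<i> + a) \<noteq> 0"
proof
  assume "w * (\<i> - a) + (\<i> + a) = 0"
  then have "w * (\<i> - a) = - (\<i> + a)"
    by (simp only: eq_neg_iff_add_eq_0)
  then have "norm (w * (\<i> - a)) = norm (\<i> + a)"
    by (metis norm_minus_cancel)
  then have "(norm (\<i> - a))\<^sup>2 = (norm (\<i> + a))\<^sup>2"
    using assms(1) by (simp add: norm_mult)
  then show False
    using assms(2) unfolding cmod_power2 by (simp add: power2_eq_square algebra_simps)
qed

lemma norm_blaschke:
  assumes "norm w = 1" "Im a \<noteq> 0"
  shows "norm (blaschke a w) = 1"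
proof -
  have "w * cnj w = 1"
    using assms(1) by (simp flip: complex_norm_square)
  then have "w * (\<i> - cnj a) + (\<i> + cnj a) = - w * cnj (w * (\<i> - a) + (\<i> + a))"
    by (simp add: algebra_simps)
  then have "norm (w * (\<i> - cnj a) + (\<i> + cnj a)) = norm (w * (\<i> - a) + (\<i> + a))"
    using assms(1) by (simp only: norm_mult norm_minus_cancel complex_mod_cnj mult_1)
  then show ?thesis
    using blaschke_denom_nz[OF assms] by (simp add: blaschke_def norm_divide)
qed

lemma norm_blaschke_list:
  assumes "norm w = 1" "nonreal L"
  shows "norm (blaschke_list L w) = 1"
  using assms(2) by (induction L) (auto simp: nonreal_def norm_mult norm_blaschke assms(1))

lemma blaschke_list_1: "blaschke_list L 1 = 1"
  by (induction L) (auto simp: blaschke_def)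

lemma cayley_denom_nz: "of_real x - \<i> \<noteq> 0"
  by (simp add: complex_eq_iff)

lemma norm_cayley [simp]: "norm (cayley x) = 1"
proof -
  have "norm (of_real x + \<i>) = norm (cnj (of_real x - \<i>))"
    by simp
  also have "\<dots> = norm (of_real x - \<i>)"
    by (rule complex_mod_cnj)
  finally show ?thesis
    using cayley_denom_nz[of x] by (simp add: cayley_def norm_divide)
qed

lemma cayley_surj:
  assumes "norm w = 1" "w \<noteq> 1"
  obtains x where "w = cayley x"
proof
  \<comment> \<open>The inverse Moebius transformation; on the unit circle its value is
    self-conjugate.\<close>
  define z where "z = \<i> * (w + 1) / (w - 1)"
  have "w * cnj w = 1"
    using assms(1) by (simp flip: complex_norm_square)
  moreover have "w \<noteq> 0"
    using assms(1) by auto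
  ultimately have "cnj w = 1 / w"
    by (simp add: eq_divide_eq mult.commute)
  then have "cnj z = z"
    using assms(2) \<open>w \<noteq> 0\<close> by (simp add: z_def field_simps)
  then have z: "z = of_real (Re z)"
    by (simp add: complex_eq_iff)
  have "z * (w - 1) = \<i> * (w + 1)"
    using assms(2) by (simp add: z_def)
  then have "(z - \<i>) * (w - 1) = 2 * \<i>" "(z + \<i>) * (w - 1) = 2 * \<i> * w"
    by (simp_all only: left_diff_distrib distrib_right) (simp_all add: algebra_simps)
  then have "(z + \<i>) * (w - 1) = w * (z - \<i>) * (w - 1)" "z - \<i> \<noteq> 0"
    by auto
  then have "z + \<i> = w * (z - \<i>)" "z - \<i> \<noteq> 0"
    using assms(2) by (metis mult_right_cancel right_minus_eq)+
  then have "w = (z + \<i>) / (z - \<i>)"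
    by (simp add: eq_divide_eq)
  then show "w = cayley (Re z)"
    using z by (simp add: cayley_def)
qed

text \<open>The link between the estimates on the real line and the loops on the circle, where the
  same function also has a value at infinity.\<close>

lemma blaschke_list_cayley: "blaschke_list L (cayley x) = phase L x"
proof -
  note nz = cayley_denom_nz[of x]
  have *: "cayley x * (\<i> - a) + (\<i> + a) = 2 * \<i> * (of_real x - a) / (of_real x - \<i>)" for a
    using nz by (simp add: cayley_def field_simps)
  have "blaschke a (cayley x) = (of_real x - a) / (of_real x - cnj a)" for a
    unfolding blaschke_def * using nz by simp
  then show ?thesis
    by (induction L) (simp_all add: phase_def)
qed

lemma continuous_on_blaschke_list_family:
  assumes c: "\<And>a. a \<in> set L \<Longrightarrow> continuous_on T (\<lambda>t. c t a)"
    and nr: "\<And>t a. t \<in> T \<Longrightarrow> a \<in> set L \<Longrightarrow> Im (c t a) \<noteq> 0"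
  shows "continuous_on (T \<times> sphere 0 1) (\<lambda>(t, w). blaschke_list (map (c t) L) w)"
  using assms
proof (induction L)
  case Nil
  then show ?case by (simp add: case_prod_unfold)
next
  case (Cons a L)
  have ca: "continuous_on (T \<times> sphere 0 1) (\<lambda>p. c (fst p) a)"
    by (rule continuous_on_compose2[OF Cons.prems(1)[of a]]) (auto intro!: continuous_intros)
  have "w * (\<i> - cnj (c t a)) + (\<i> + cnj (c t a)) \<noteq> 0" if "t \<in> T" "norm w = 1" for t w
    using blaschke_denom_nz[of w "cnj (c t a)"] that Cons.prems(2)[of t a] by simp
  then have "continuous_on (T \<times> sphere 0 1) (\<lambda>p. blaschke (c (fst p) a) (snd p))"
    unfolding blaschke_def by (intro continuous_intros ca) auto
  then show ?case
    using Cons by (auto simp: case_prod_unfold intro!: continuous_intros)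
qed

text \<open>Joint continuity on the compact product of parameters and circle is uniform, so a small
  change of the parameter moves the whole loop little. It serves both the contraction and the
  perturbation of roots into general position.\<close>

lemma blaschke_list_family_uniform:
  assumes "compact T" "\<And>a. a \<in> set L \<Longrightarrow> continuous_on T (\<lambda>t. c t a)"
    and "\<And>t a. t \<in> T \<Longrightarrow> a \<in> set L \<Longrightarrow> Im (c t a) \<noteq> 0" and "\<epsilon> > 0"
  obtains \<delta> where "\<delta> > 0"
    "\<And>s t w. s \<in> T \<Longrightarrow> t \<in> T \<Longrightarrow> dist s t < \<delta> \<Longrightarrow> norm w = 1 \<Longrightarrow>
      dist (blaschke_list (map (c s) L) w) (blaschke_list (map (c t) L) w) < \<epsilon>"
proof -
  have "uniformly_continuous_on (T \<times> sphere 0 1) (\<lambda>(t, w). blaschke_list (map (c t) L) w)"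
    by (intro compact_uniformly_continuous continuous_on_blaschke_list_family compact_Times assms
        compact_sphere)
  then obtain \<delta> where "\<delta> > 0" and \<delta>: "\<And>p q. p \<in> T \<times> sphere 0 1 \<Longrightarrow> q \<in> T \<times> sphere 0 1 \<Longrightarrow> dist q p < \<delta> \<Longrightarrow>
      dist (case q of (t, w) \<Rightarrow> blaschke_list (map (c t) L) w)
        (case p of (t, w) \<Rightarrow> blaschke_list (map (c t) L) w) < \<epsilon>"
    using \<open>\<epsilon> > 0\<close> unfolding uniformly_continuous_on_def by metis
  show ?thesis
  proof (rule that[OF \<open>\<delta> > 0\<close>])
    fix s t and w :: complex assume "s \<in> T" "t \<in> T" "dist s t < \<delta>" "norm w = 1"
    then show "dist (blaschke_list (map (c s) L) w) (blaschke_list (map (c t) L) w) < \<epsilon>"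
      using \<delta>[of "(t, w)" "(s, w)"] by (simp add: dist_Pair_Pair)
  qed
qed

lemma continuous_on_blaschke_list:
  assumes "nonreal L"
  shows "continuous_on (sphere 0 1) (blaschke_list L)"
proof -
  have "continuous_on ({0::real} \<times> sphere 0 1) (\<lambda>(t, w). blaschke_list (map (\<lambda>a. a) L) w)"
    using assms by (intro continuous_on_blaschke_list_family) (auto simp: nonreal_def)
  then have "continuous_on (sphere 0 1) (\<lambda>w. (\<lambda>(t, w). blaschke_list (map (\<lambda>a. a) L) w) (0::real, w))"
    by (rule continuous_on_compose2) (auto intro!: continuous_intros)
  then show ?thesis by simp
qed

lemma continuous_contract_root: "continuous_on T (\<lambda>t. contract_root t a)"
  unfolding contract_root_def by (intro continuous_intros)

lemma Im_contract_root_nz: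
  "0 \<le> t \<Longrightarrow> t \<le> 1 \<Longrightarrow> Im a \<noteq> 0 \<Longrightarrow> Im (contract_root t a) \<noteq> 0"
  using Im_contract_root[of t a] by (cases "Im a > 0") auto

text \<open>The sign follows from the model cases: the root \<open>- \<i>\<close> contributes the
  factor \<open>w\<close>, the root \<open>\<i>\<close> the factor \<open>1 / w\<close>.\<close>

definition root_degree :: "complex list \<Rightarrow> int" where
  "root_degree L = int (length (lower_roots L)) - int (length (upper_roots L))"

lemma length_roots:
  assumes "nonreal L"
  shows "length (lower_roots L) + length (upper_roots L) = length L"
  using assms by (induction L) (auto simp: nonreal_def lower_roots_def upper_roots_def)

lemma blaschke_i: "blaschke \<i> w = 1 / w" "blaschke (- \<i>) w = w"
proof -
  have "\<i> * (w * \<i>) = - w" by (simp add: complex_eq_iff)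
  then show "blaschke \<i> w = 1 / w" "blaschke (- \<i>) w = w"
    by (simp_all add: blaschke_def)
qed

text \<open>The motion ends at a power map that depends on the roots only through their degree. It
  is the point to which a degree class contracts, and its winding number can be read off.\<close>

lemma blaschke_list_contract_1:
  assumes "nonreal L" "w \<noteq> 0"
  shows "blaschke_list (map (contract_root 1) L) w = w powi root_degree L"
  using assms(1)
proof (induction L)
  case Nil
  then show ?case by (simp add: root_degree_def lower_roots_def upper_roots_def)
next
  case (Cons a L)
  then have IH: "blaschke_list (map (contract_root 1) L) w = w powi root_degree L" and "Im a \<noteq> 0"
    by (auto simp: nonreal_def)
  then consider "Im a > 0" | "Im a < 0" by linarith
  then show ?case
  proof cases
    case 1
    then have "root_degree (a # L) = root_degree L - 1" "contract_root 1 a = \<i>"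
      by (auto simp: root_degree_def lower_roots_def upper_roots_def contract_root_def)
    then show ?thesis
      using assms(2) IH by (simp add: blaschke_i power_int_diff)
  next
    case 2
    then have "root_degree (a # L) = 1 + root_degree L" "contract_root 1 a = - \<i>"
      by (auto simp: root_degree_def lower_roots_def upper_roots_def contract_root_def)
    then show ?thesis
      using assms(2) IH by (simp add: blaschke_i power_int_add)
  qed
qed

lemma contract_root_0 [simp]: "contract_root 0 a = a"
  by (simp add: contract_root_def)

text \<open>Moving the roots to \<open>\<i>\<close> and \<open>- \<i>\<close> is a homotopy of loops
  avoiding 0, and the resulting power map has an explicit logarithm.\<close>

lemma winding_number_blaschke_list:
  assumes "nonreal L"
  shows "winding_number (circle_loop (blaschke_list L)) 0 = of_int (root_degree L)"
proof -
  define e where "e s = exp (2 * of_real pi * \<i> * complex_of_real s)" for s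
  define H where "H = (\<lambda>(t, s). blaschke_list (map (contract_root t) L) (e s))"
  have e: "norm (e s) = 1" for s by (simp add: e_def)
  have cl: "circle_loop g = (\<lambda>s. g (e s))" for g
    by (simp add: circle_loop_def [abs_def] e_def)
  have "continuous_on ({0..1} \<times> sphere 0 1) (\<lambda>(t, w). blaschke_list (map (contract_root t) L) w)"
    using assms Im_contract_root_nz
    by (intro continuous_on_blaschke_list_family continuous_contract_root) (auto simp: nonreal_def)
  then have "continuous_on ({0..1} \<times> {0..1})
      (\<lambda>p. (\<lambda>(t, w). blaschke_list (map (contract_root t) L) w) (fst p, e (snd p)))"
    by (rule continuous_on_compose2) (auto simp: e intro!: continuous_intros, auto simp: e_def intro!: continuous_intros)
  then have H: "continuous_on ({0..1} \<times> {0..1}) H"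
    by (simp add: H_def case_prod_unfold)
  have "blaschke_list (map (contract_root t) L) (e s) \<noteq> 0" if "t \<in> {0..1}" for t s
    using norm_blaschke_list[OF e nonreal_contract[OF _ _ assms], of t s] that by force
  then have "homotopic_loops (- {0}) (circle_loop (blaschke_list L))
      (circle_loop (blaschke_list (map (contract_root 1) L)))"
    unfolding homotopic_loops cl
    by (intro exI[of _ H] conjI H)
      (auto simp: H_def map_idI pathfinish_def pathstart_def e_def)
  then have "winding_number (circle_loop (blaschke_list L)) 0
      = winding_number (circle_loop (blaschke_list (map (contract_root 1) L))) 0"
    by (rule winding_number_homotopic_loops)
  moreover have "2 * of_real pi * \<i> * winding_number (circle_loop (blaschke_list (map (contract_root 1) L))) 0
      = 2 * of_real pi * \<i> * of_int (root_degree L) * of_real 1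
        - 2 * of_real pi * \<i> * of_int (root_degree L) * of_real 0"
  proof (rule winding_number_continuous_log)
    have nr: "nonreal (map (contract_root 1) L)"
      by (rule nonreal_contract) (use assms in auto)
    show "path (circle_loop (blaschke_list (map (contract_root 1) L)))"
      by (rule path_circle_loop [OF continuous_on_blaschke_list [OF nr]])
    show "0 \<notin> path_image (circle_loop (blaschke_list (map (contract_root 1) L)))"
      using norm_blaschke_list[OF _ nr] by (intro circle_loop_nz) force
    show "continuous_on {0..1} (\<lambda>t. 2 * of_real pi * \<i> * of_int (root_degree L) * complex_of_real t)"
      by (intro continuous_intros)
    fix t :: real
    have "exp (of_int k * z) = exp z powi k" for k and z :: complex
      by (simp add: exp_power_int mult.commute)
    from this[of "root_degree L" "2 * of_real pi * \<i> * of_real t"]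
    show "circle_loop (blaschke_list (map (contract_root 1) L)) t
        = 0 + exp (2 * of_real pi * \<i> * of_int (root_degree L) * of_real t)"
      unfolding circle_loop_def
      by (subst blaschke_list_contract_1[OF assms]) (simp_all add: algebra_simps)
  qed
  ultimately show ?thesis by simp
qed

text \<open>The coordinates have modulus 1, so a distance below 1 keeps the segments between
  corresponding values away from 0.\<close>

lemma degree_locally_constant:
  assumes "f \<in> loops" "g \<in> loops" "\<And>w. norm w = 1 \<Longrightarrow> dist (loop_coord g w) (loop_coord f w) < 1"
  shows "RP1_degree g = RP1_degree f"
proof -
  have "pathfinish (circle_loop h) = pathstart (circle_loop h)" for h
    by (simp add: circle_loop_def pathfinish_def pathstart_def)
  then have "winding_number (circle_loop (loop_coord g)) 0 = winding_number (circle_loop (loop_coord f)) 0"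
    using assms norm_loop_coord[OF assms(1)]
    by (intro winding_number_nearby_loops_eq path_circle_loop continuous_on_loop_coord)
      (auto simp: circle_loop_def dist_norm)
  then show ?thesis
    using RP1_degree_winding_number[OF assms(1)] RP1_degree_winding_number[OF assms(2)]
    by (metis of_int_eq_iff)
qed

text \<open>For non-real roots exactly one loop has these coordinates; for other lists the choice
  carries no information.\<close>

definition root_loop :: "complex list \<Rightarrow> (nat \<Rightarrow> real) set \<Rightarrow> (nat \<Rightarrow> real) set" where
  "root_loop L = (SOME f. f \<in> loops \<and> (\<forall>w. norm w = 1 \<longrightarrow> loop_coord f w = blaschke_list L w))"

lemma root_loop:
  assumes "nonreal L"
  shows "root_loop L \<in> loops" "\<And>w. norm w = 1 \<Longrightarrow> loop_coord (root_loop L) w = blaschke_list L w"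
proof -
  obtain f where "f \<in> loops" "\<And>w. norm w = 1 \<Longrightarrow> loop_coord f w = blaschke_list L w"
    using loop_coord_surj[OF continuous_on_blaschke_list[OF assms] norm_blaschke_list[OF _ assms] blaschke_list_1]
    by blast
  then have "\<exists>f. f \<in> loops \<and> (\<forall>w. norm w = 1 \<longrightarrow> loop_coord f w = blaschke_list L w)"
    by blast
  from someI_ex[OF this]
  show "root_loop L \<in> loops" "\<And>w. norm w = 1 \<Longrightarrow> loop_coord (root_loop L) w = blaschke_list L w"
    unfolding root_loop_def by blast+
qed

lemma root_loop_eqI:
  assumes "f \<in> loops" "nonreal L" "\<And>w. norm w = 1 \<Longrightarrow> loop_coord f w = blaschke_list L w"
  shows "f = root_loop L"
  using assms root_loop[OF assms(2)] by (intro loop_coord_inject) auto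

lemma RP1_degree_root_loop:
  assumes "nonreal L"
  shows "RP1_degree (root_loop L) = root_degree L"
proof -
  have "winding_number (circle_loop (loop_coord (root_loop L))) 0
      = winding_number (circle_loop (blaschke_list L)) 0"
    by (rule winding_number_cong) (simp add: circle_loop_def root_loop[OF assms])
  then show ?thesis
    using RP1_degree_winding_number[OF root_loop(1)[OF assms]] winding_number_blaschke_list[OF assms]
    by (metis of_int_eq_iff)
qed

text \<open>The bound \<open>r < \<epsilon>\<close>, uniform in \<open>w\<close>, says that the
  supremum of the distances is below \<open>\<epsilon>\<close>; the margin
  \<open>\<epsilon> - r\<close> is then available for the triangle inequality.\<close>

lemma openin_loop_ball:
  assumes "f \<in> loops"
  shows "openin (loop_RP 1) {g \<in> loops. \<exists>r<\<epsilon>. \<forall>w. norm w = 1 \<longrightarrow> dist (loop_coord g w) (loop_coord f w) \<le> r}"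
  unfolding openin_loop_RP_iff
proof (intro conjI ballI)
  let ?B = "{g \<in> loops. \<exists>r<\<epsilon>. \<forall>w. norm w = 1 \<longrightarrow> dist (loop_coord g w) (loop_coord f w) \<le> r}"
  show "?B \<subseteq> loops" by blast
  fix g assume "g \<in> ?B"
  then obtain r where r: "r < \<epsilon>" "\<And>w. norm w = 1 \<Longrightarrow> dist (loop_coord g w) (loop_coord f w) \<le> r"
    by blast
  define d where "d = (\<epsilon> - r) / 2"
  have d: "d > 0" "r + d < \<epsilon>" using r(1) by (auto simp: d_def field_simps)
  have "h \<in> ?B" if h: "h \<in> loops" "\<And>w. norm w = 1 \<Longrightarrow> dist (loop_coord h w) (loop_coord g w) < d" for h
  proof -
    have "dist (loop_coord h w) (loop_coord f w) \<le> r + d" if "norm w = 1" for w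
      using r(2)[OF that] h(2)[OF that]
        dist_triangle[of "loop_coord h w" "loop_coord f w" "loop_coord g w"] by linarith
    then show ?thesis using h(1) d(2) by blast
  qed
  then show "\<exists>\<epsilon>>0. \<forall>h\<in>loops. (\<forall>w. norm w = 1 \<longrightarrow> dist (loop_coord h w) (loop_coord g w) < \<epsilon>) \<longrightarrow> h \<in> ?B"
    using d(1) by blast
qed

subsection \<open>Based rational maps and their roots\<close>

lemma of_real_poly_map_poly:
  "poly (map_poly of_real p) (of_real x :: complex) = of_real (poly p x)"
  by (induction p) (simp_all add: map_poly_pCons)

lemma phase_root_prod: "phase L x = root_prod L (of_real x) / cnj (root_prod L (of_real x))"
  by (induction L) (simp_all add: phase_def)

lemma complex_poly_factor_list:
  fixes p :: "complex poly"
  assumes "p \<noteq> 0"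
  obtains L where "length L = degree p" "\<And>z. poly p z = lead_coeff p * root_prod L z"
proof -
  obtain A where A: "size A = degree p" "p = smult (lead_coeff p) (\<Prod>x\<in>#A. [:- x, 1:])"
    using alg_closed_imp_factorization[OF assms] by blast
  obtain L where L: "mset L = A"
    using ex_mset by blast
  have "poly (\<Prod>x\<in>#mset L. [:- x, 1:]) z = root_prod L z" for z
    by (induction L) (simp_all add: algebra_simps)
  then have "poly p z = lead_coeff p * root_prod L z" for z
    using A(2) L by (metis poly_smult)
  moreover have "length L = degree p"
    using A(1) L by (metis size_mset)
  ultimately show ?thesis
    using that by blast
qed

lemma RP1_affine_point: "RP1_affine x = RP1_point (of_real x + \<i>)"
  by (simp add: RP1_affine_def homog_1_point Complex_eq)

lemma RP1_affine_in: "RP1_affine x \<in> topspace (RP 1)"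
  by (auto simp: RP1_affine_point topspace_RP1 complex_eq_iff intro!: imageI)

lemma RP1_inv_cayley: "RP1_inv (cayley x) = RP1_affine x"
proof -
  have "RP1_coord (RP1_affine x) = cayley x"
    by (simp add: RP1_affine_point cayley_def)
  then show ?thesis
    using RP1_inv_coord[OF RP1_affine_in[of x]] by simp
qed

lemma loop_coord_eqI:
  assumes "f \<in> loops" "g 1 = 1" "\<And>x. loop_coord f (cayley x) = g (cayley x)" "norm w = 1"
  shows "loop_coord f w = g w"
  using assms cayley_surj[of w] loop_coord_1[OF assms(1)] by metis

text \<open>Division by \<open>1 + \<i>\<close> turns the direction of the base point into the real
  axis. Its effect on \<open>z / cnj z\<close> is the factor
  \<open>(1 - \<i>) / (1 + \<i>) = - \<i>\<close>, the rotation built into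
  \<open>loop_coord\<close>.\<close>

lemma loop_coord_cayley_point:
  assumes "f (RP1_affine x) = RP1_point (Complex a b)"
  shows "loop_coord f (cayley x) = (Complex a b / (1 + \<i>)) / cnj (Complex a b / (1 + \<i>))"
proof -
  have "(1 - \<i>) / (1 + \<i>) = - \<i>"
    by (simp add: complex_eq_iff Re_divide Im_divide)
  moreover have "(z / c) / cnj (z / c) = z / cnj z * (cnj c / c)" for z c :: complex
    by (simp add: mult.commute)
  from this[of "Complex a b" "1 + \<i>"]
  have "(Complex a b / (1 + \<i>)) / cnj (Complex a b / (1 + \<i>))
      = Complex a b / cnj (Complex a b) * ((1 - \<i>) / (1 + \<i>))"
    by simp
  ultimately show ?thesis
    by (simp only: loop_coord_def RP1_inv_cayley assms RP1_coord_point) simp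
qed

lemma poly_complex_combination:
  fixes p q :: "real poly"
  shows "poly (map_poly of_real p + smult \<i> (map_poly of_real q)) (of_real x)
    = Complex (poly p x) (poly q x)"
  by (simp add: Complex_eq of_real_poly_map_poly)

text \<open>The two monic polynomials are the real and imaginary parts of
  \<open>(1 + \<i>) * F\<close> on the real line, so \<open>F\<close> is monic and a real root of
  \<open>F\<close> would be a common zero of both.\<close>

lemma RRat_imp_root_loop:
  assumes f: "f \<in> RRat n 1" "f \<in> loops"
  obtains L where "length L = n" "nonreal L" "f = root_loop L"
proof -
  obtain p where p: "\<And>i. i \<le> 1 \<Longrightarrow> degree (p i) = n" "\<And>i. i \<le> 1 \<Longrightarrow> lead_coeff (p i) = 1"
    and cop: "\<not> (\<exists>z::complex. \<forall>i\<le>1. poly (map_poly complex_of_real (p i)) z = 0)"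
    and fx: "\<And>x. f (RP1_affine x) = homog 1 (\<lambda>i. poly (p i) x)"
    using f(1) unfolding RRat_def by blast
  define F where "F = smult (1 / (1 + \<i>)) (map_poly of_real (p 0) + smult \<i> (map_poly of_real (p 1)))"
  have i1: "1 + \<i> \<noteq> 0" by (simp add: complex_eq_iff)
  have coeff: "poly.coeff F k = (of_real (poly.coeff (p 0) k) + \<i> * of_real (poly.coeff (p 1) k)) / (1 + \<i>)" for k
    by (simp add: F_def coeff_map_poly)
  have lead: "poly.coeff F n = 1"
    using p(1)[of 0] p(1)[of 1] p(2)[of 0] p(2)[of 1] i1 by (simp add: coeff)
  have "degree F \<le> n"
    by (rule degree_le) (use p(1)[of 0] p(1)[of 1] in \<open>auto simp: coeff coeff_eq_0\<close>)
  then have deg: "degree F = n"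
    using lead by (metis le_antisym le_degree zero_neq_one)
  then have "F \<noteq> 0" "lead_coeff F = 1"
    using lead by auto
  then obtain L where L: "length L = n" "\<And>z. poly F z = root_prod L z"
    using complex_poly_factor_list[of F] deg by (metis mult_1)
  have Fx: "poly F (of_real x) = Complex (poly (p 0) x) (poly (p 1) x) / (1 + \<i>)" for x
    unfolding F_def poly_smult poly_complex_combination by simp
  have "nonreal L"
    unfolding nonreal_def
  proof (intro ballI notI)
    fix a assume a: "a \<in> set L" "Im a = 0"
    then have "a = of_real (Re a)" by (simp add: complex_eq_iff)
    then have "poly F (of_real (Re a)) = 0"
      using a(1) L(2) root_prod_eq_0_iff by metis
    then have "poly (p 0) (Re a) = 0" "poly (p 1) (Re a) = 0"
      using i1 by (simp_all add: Fx complex_eq_iff[of "Complex _ _"])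
    then have "poly (map_poly complex_of_real (p i)) (of_real (Re a)) = 0" if "i \<le> 1" for i
      using that by (cases "i = 0") (auto simp: le_Suc_eq One_nat_def of_real_poly_map_poly)
    then show False using cop by blast
  qed
  moreover have "loop_coord f w = blaschke_list L w" if "norm w = 1" for w
  proof (rule loop_coord_eqI[where g = "blaschke_list L", OF f(2) blaschke_list_1 _ that])
    fix x
    have "loop_coord f (cayley x) = poly F (of_real x) / cnj (poly F (of_real x))"
      unfolding Fx using fx[of x] by (intro loop_coord_cayley_point) (simp add: homog_1_point)
    then show "loop_coord f (cayley x) = blaschke_list L (cayley x)"
      by (simp add: blaschke_list_cayley phase_root_prod L(2))
  qed
  ultimately show ?thesis
    using that L(1) root_loop_eqI[OF f(2)] by blast
qed

lemma root_poly:
  fixes L :: "complex list"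
  obtains F where "degree F = length L" "lead_coeff F = 1" "\<And>z. poly F z = root_prod L z"
proof
  let ?F = "\<Prod>a\<leftarrow>L. [:- a, 1:]"
  have "degree ?F = length L \<and> lead_coeff ?F = 1"
  proof (induction L)
    case (Cons a L)
    then have IH: "degree (\<Prod>a\<leftarrow>L. [:- a, 1:]) = length L"
        "poly.coeff (\<Prod>a\<leftarrow>L. [:- a, 1:]) (length L) = 1" and "(\<Prod>a\<leftarrow>L. [:- a, 1:]) \<noteq> 0"
      by auto
    then have "degree ([:- a, 1:] * (\<Prod>a\<leftarrow>L. [:- a, 1:])) = 1 + length L"
      using \<open>(\<Prod>a\<leftarrow>L. [:- a, 1:]) \<noteq> 0\<close> by (subst degree_mult_eq) (auto simp: IH)
    moreover have "lead_coeff ([:- a, 1:] * (\<Prod>a\<leftarrow>L. [:- a, 1:])) = 1"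
      unfolding lead_coeff_mult by (simp add: IH)
    ultimately show ?case by (simp only: list.map prod_list.Cons list.size) simp
  qed simp
  then show "degree ?F = length L" "lead_coeff ?F = 1" by auto
  show "poly ?F z = root_prod L z" for z
    by (induction L) (simp_all add: algebra_simps)
qed

text \<open>Real and imaginary parts of the coefficients of \<open>(1 + \<i>) * F\<close> give the
  pair of real polynomials. A common zero \<open>z\<close> is a zero of that polynomial and of its
  conjugate, which puts both \<open>z\<close> and \<open>cnj z\<close> into
  \<open>L\<close>.\<close>

lemma root_loop_in_RRat:
  assumes L: "nonreal L" and cop: "\<And>a. a \<in> set L \<Longrightarrow> cnj a \<notin> set L"
  shows "root_loop L \<in> RRat (length L) 1"
proof -
  let ?n = "length L"
  obtain F where F: "degree F = ?n" "lead_coeff F = 1" "\<And>z. poly F z = root_prod L z"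
    using root_poly by blast
  define G where "G = smult (1 + \<i>) F"
  define p where "p i = (if i = 0 then map_poly Re G else map_poly Im G)" for i :: nat
  have coeff: "poly.coeff (p 0) k = Re (poly.coeff G k)" "poly.coeff (p 1) k = Im (poly.coeff G k)" for k
    by (simp_all add: p_def coeff_map_poly)
  have Gn: "poly.coeff G ?n = 1 + \<i>" "\<And>k. k > ?n \<Longrightarrow> poly.coeff G k = 0"
    using F(1,2) by (auto simp: G_def coeff_eq_0)
  have deg: "degree (p i) = ?n" "lead_coeff (p i) = 1" if "i \<le> 1" for i
  proof -
    have cn: "poly.coeff (p i) ?n = 1"
      using that coeff Gn by (cases "i = 0") (auto simp: le_Suc_eq One_nat_def)
    have "degree (p i) \<le> ?n"
      by (rule degree_le) (use that coeff Gn in \<open>cases "i = 0"; auto simp: le_Suc_eq One_nat_def\<close>)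
    then show "degree (p i) = ?n"
      using cn by (metis le_antisym le_degree zero_neq_one)
    with cn show "lead_coeff (p i) = 1" by simp
  qed
  have G: "map_poly of_real (p 0) + smult \<i> (map_poly of_real (p 1)) = G"
    "map_poly of_real (p 0) - smult \<i> (map_poly of_real (p 1)) = map_poly cnj G"
    by (rule poly_eqI; simp add: coeff_map_poly coeff complex_eq_iff)+
  have "\<not> (\<exists>z::complex. \<forall>i\<le>1. poly (map_poly complex_of_real (p i)) z = 0)"
  proof
    assume "\<exists>z::complex. \<forall>i\<le>1. poly (map_poly complex_of_real (p i)) z = 0"
    then obtain z where z: "poly (map_poly complex_of_real (p 0)) z = 0" "poly (map_poly complex_of_real (p 1)) z = 0"
      by auto
    have "poly G z = 0"
      unfolding G(1)[symmetric] by (simp add: z)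
    moreover have "poly (map_poly cnj G) z = 0"
      unfolding G(2)[symmetric] by (simp add: z)
    ultimately have "poly F z = 0" "poly F (cnj z) = 0"
      by (auto simp: poly_map_poly_cnj G_def complex_eq_iff[of "1 + \<i>"])
    then show False
      using cop[of z] by (simp add: F(3) root_prod_eq_0_iff)
  qed
  moreover have "root_loop L (RP1_affine x) = homog 1 (\<lambda>i. poly (p i) x)" for x
  proof -
    have Gx: "poly G (of_real x) = Complex (poly (p 0) x) (poly (p 1) x)"
      using poly_complex_combination[of "p 0" "p 1" x] by (simp add: G)
    have "root_prod L (of_real x) \<noteq> 0"
      using L by (auto simp: root_prod_eq_0_iff nonreal_def)
    then have Gnz: "poly G (of_real x) \<noteq> 0"
      by (auto simp: G_def F(3) complex_eq_iff[of "1 + \<i>"])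
    have "loop_coord (root_loop L) (cayley x) = phase L x"
      using root_loop(2)[OF L, of "cayley x"] by (simp add: blaschke_list_cayley)
    then have "RP1_coord (root_loop L (RP1_affine x)) = \<i> * phase L x"
      by (simp add: loop_coord_def RP1_inv_cayley flip: minus_mult_right) (simp add: complex_eq_iff)
    also have "\<dots> = poly G (of_real x) / cnj (poly G (of_real x))"
    proof -
      have "((1 + \<i>) * z) / cnj ((1 + \<i>) * z) = (1 + \<i>) / (1 - \<i>) * (z / cnj z)" for z
        by simp
      moreover have "(1 + \<i>) / (1 - \<i>) = \<i>"
        by (simp add: complex_eq_iff Re_divide Im_divide)
      ultimately show ?thesis
        by (simp only: phase_root_prod G_def F(3) poly_smult)
    qed
    also have "\<dots> = RP1_coord (RP1_point (poly G (of_real x)))"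
      by simp
    finally have "RP1_coord (root_loop L (RP1_affine x)) = RP1_coord (RP1_point (poly G (of_real x)))" .
    moreover have "RP1_point (poly G (of_real x)) \<in> topspace (RP 1)"
      using Gnz by (simp add: topspace_RP1)
    ultimately have "root_loop L (RP1_affine x) = RP1_point (poly G (of_real x))"
      using inj_onD[OF inj_RP1_coord] loop_in[OF root_loop(1)[OF L] RP1_affine_in] by blast
    then show ?thesis
      by (simp add: Gx homog_1_point)
  qed
  moreover have "root_loop L \<in> extensional (topspace (RP 1))" "root_loop L RP1_infinity = base_pt 1"
    using root_loop(1)[OF L] by (auto simp: loops_iff continuous_maps_def)
  ultimately show ?thesis
    unfolding RRat_def using deg by blast
qed

subsection \<open>The closure of the rational maps\<close>

lemma closure_RRat_iff:
  "f \<in> loop_RP 1 closure_of RRat n 1 \<longleftrightarrow> f \<in> loops \<and>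
    (\<forall>\<epsilon>>0. \<exists>g\<in>RRat n 1 \<inter> loops. \<forall>w. norm w = 1 \<longrightarrow> dist (loop_coord g w) (loop_coord f w) < \<epsilon>)"
    (is "?lhs \<longleftrightarrow> ?rhs")
proof
  assume L: ?lhs
  then have f: "f \<in> loops" by (simp add: in_closure_of)
  have "\<exists>g\<in>RRat n 1 \<inter> loops. \<forall>w. norm w = 1 \<longrightarrow> dist (loop_coord g w) (loop_coord f w) < \<epsilon>"
    if "\<epsilon> > 0" for \<epsilon>
  proof -
    define B where "B = {g \<in> loops. \<exists>r<\<epsilon>. \<forall>w. norm w = 1 \<longrightarrow> dist (loop_coord g w) (loop_coord f w) \<le> r}"
    have "f \<in> B"
      using f that unfolding B_def by (intro CollectI conjI exI[of _ 0]) auto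
    moreover have "openin (loop_RP 1) B"
      unfolding B_def by (rule openin_loop_ball[OF f])
    ultimately obtain g where g: "g \<in> RRat n 1" "g \<in> B"
      using L unfolding in_closure_of by blast
    then obtain r where r: "g \<in> loops" "r < \<epsilon>"
        "\<And>w. norm w = 1 \<Longrightarrow> dist (loop_coord g w) (loop_coord f w) \<le> r"
      unfolding B_def by blast
    have "dist (loop_coord g w) (loop_coord f w) < \<epsilon>" if "norm w = 1" for w
      using r(2) r(3)[OF that] by linarith
    then show ?thesis
      using g(1) r(1) by blast
  qed
  with f show ?rhs by blast
next
  define near where "near \<epsilon> f g \<longleftrightarrow> (\<forall>w. norm w = 1 \<longrightarrow> dist (loop_coord g w) (loop_coord f w) < \<epsilon>)"
    for \<epsilon> :: real and f g
  note op = openin_loop_RP_iff [folded near_def]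
  assume R: ?rhs
  then have R: "f \<in> loops" "\<forall>\<epsilon>>0. \<exists>g\<in>RRat n 1 \<inter> loops. near \<epsilon> f g"
    unfolding near_def by blast+
  have "\<exists>g. g \<in> RRat n 1 \<and> g \<in> T" if T: "f \<in> T" "openin (loop_RP 1) T" for T
  proof -
    obtain \<epsilon> where "\<epsilon> > 0" "\<forall>g\<in>loops. near \<epsilon> f g \<longrightarrow> g \<in> T"
      using T unfolding op by blast
    then show ?thesis using R(2) by blast
  qed
  with R(1) show ?lhs
    unfolding in_closure_of by blast
qed

text \<open>A list with conjugate pairs is not directly a rational map of full degree. Shifting the
  upper roots slightly upwards by a generic amount destroys all such pairs and changes the loop
  little.\<close>

lemma root_loop_in_closure:
  assumes L: "nonreal L"
  shows "root_loop L \<in> loop_RP 1 closure_of RRat (length L) 1"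
  unfolding closure_RRat_iff
proof (intro conjI allI impI)
  show "root_loop L \<in> loops" by (rule root_loop(1)[OF L])
  fix \<epsilon> :: real assume "\<epsilon> > 0"
  define c where "c t a = (if Im a > 0 then a + of_real t * \<i> else a)" for t a
  have c_nr: "Im (c t a) \<noteq> 0" if "t \<in> {0..1}" "a \<in> set L" for t a
    using that L by (auto simp: c_def nonreal_def)
  have "continuous_on {0..1} (\<lambda>t. c t a)" for a
    by (cases "Im a > 0") (auto simp: c_def intro!: continuous_intros)
  then obtain \<delta> where \<delta>: "\<delta> > 0"
    "\<And>s t w. s \<in> {0..1} \<Longrightarrow> t \<in> {0..1} \<Longrightarrow> dist s t < \<delta> \<Longrightarrow> norm w = 1 \<Longrightarrow>
      dist (blaschke_list (map (c s) L) w) (blaschke_list (map (c t) L) w) < \<epsilon>"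
    using blaschke_list_family_uniform[of "{0..1}" L c \<epsilon>] c_nr \<open>\<epsilon> > 0\<close> by auto
  \<comment> \<open>Contains every shift at which an upper root, once moved, could become conjugate
    to a lower one; it is finite, so arbitrarily small shifts avoid it.\<close>
  define B where "B = (\<lambda>(a, b). - Im b - Im a) ` (set L \<times> set L)"
  have "infinite ({0<..<min \<delta> 1} - B)"
    using \<delta>(1) by (intro Diff_infinite_finite) (auto simp: B_def)
  then obtain t where t: "0 < t" "t < \<delta>" "t < 1" "t \<notin> B"
    by (metis (no_types, lifting) DiffD1 DiffD2 all_not_in_conv finite.emptyI greaterThanLessThan_iff min_less_iff_conj)
  let ?M = "map (c t) L"
  have M: "nonreal ?M"
    using c_nr t by (auto simp: nonreal_def)
  have "cnj a \<notin> set ?M" if a: "a \<in> set ?M" for a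
  proof
    assume "cnj a \<in> set ?M"
    then obtain u v where uv: "u \<in> set L" "v \<in> set L" "a = c t u" "cnj a = c t v"
      using a by auto
    then have *: "Im (c t v) = - Im (c t u)" by (metis cnj.simps(2))
    have nz: "Im u \<noteq> 0" "Im v \<noteq> 0" using uv L by (auto simp: nonreal_def)
    have "t \<in> B"
    proof (cases "Im u > 0")
      case True
      then have "t = - Im v - Im u"
        using * t nz by (auto simp: c_def split: if_splits)
      then show ?thesis using uv by (auto simp: B_def intro!: image_eqI[of _ _ "(u, v)"])
    next
      case False
      then have "t = - Im u - Im v"
        using * t nz by (auto simp: c_def split: if_splits)
      then show ?thesis using uv by (auto simp: B_def intro!: image_eqI[of _ _ "(v, u)"])
    qed
    with t(4) show False ..
  qed
  then have "root_loop ?M \<in> RRat (length L) 1"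
    using root_loop_in_RRat[OF M] by simp
  moreover have "dist (loop_coord (root_loop ?M) w) (loop_coord (root_loop L) w) < \<epsilon>" if "norm w = 1" for w
  proof -
    have "map (c 0) L = L" by (auto simp: c_def intro!: map_idI)
    then show ?thesis
      using \<delta>(2)[of t 0 w] t that by (simp add: root_loop M L)
  qed
  ultimately show "\<exists>g\<in>RRat (length L) 1 \<inter> loops. \<forall>w. norm w = 1 \<longrightarrow>
      dist (loop_coord g w) (loop_coord (root_loop L) w) < \<epsilon>"
    using root_loop(1)[OF M] by blast
qed

text \<open>The circle is connected with more than one point, so it has no isolated points and the
  complement of a finite subset is dense.\<close>

lemma eq_on_sphere_if_cofinite:
  fixes f g :: "complex \<Rightarrow> complex"
  assumes "continuous_on (sphere 0 1) f" "continuous_on (sphere 0 1) g" "finite A"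
    and eq: "\<And>w. norm w = 1 \<Longrightarrow> w \<notin> A \<Longrightarrow> f w = g w" and w: "norm w = 1"
  shows "f w = g w"
proof -
  have "connected (sphere (0::complex) 1)"
    by (rule connected_sphere) simp
  moreover have "sphere 0 1 \<noteq> {x}" for x :: complex
  proof
    assume "sphere 0 1 = {x}"
    then have "(1::complex) \<in> {x}" "(-1::complex) \<in> {x}" by (auto simp flip: \<open>sphere 0 1 = {x}\<close>)
    then show False by simp
  qed
  ultimately have "w islimpt sphere 0 1"
    using w by (intro connected_imp_perfect) auto
  then have "w islimpt (sphere 0 1 - A) \<union> A"
    by (rule islimpt_subset) blast
  then have "w islimpt (sphere 0 1 - A)"
    using islimpt_Un_finite[OF assms(3), of w "sphere 0 1 - A"] by (simp only: Un_commute)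
  then have "w \<in> closure (sphere 0 1 - A)"
    by (simp add: closure_def)
  moreover have "closure (sphere 0 1 - A) \<subseteq> sphere (0::complex) 1"
    by (rule closure_minimal) auto
  then have "continuous_on (closure (sphere 0 1 - A)) (\<lambda>w. f w - g w)"
    by (intro continuous_intros continuous_on_subset[OF assms(1)] continuous_on_subset[OF assms(2)])
  ultimately have "f w - g w = 0"
    by (rule continuous_constant_on_closure[rotated 2]) (use eq in auto)
  then show ?thesis by simp
qed

lemma phase_filter_nonreal:
  assumes "of_real x \<notin> set L"
  shows "phase L x = phase (filter (\<lambda>a. Im a \<noteq> 0) L) x"
  using assms
proof (induction L)
  case (Cons a L)
  have "of_real x - a \<noteq> 0" using Cons.prems by auto
  moreover have "cnj a = a" if "Im a = 0" using that by (simp add: complex_eq_iff)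
  ultimately show ?case using Cons by (auto simp: phase_def)
qed (simp add: phase_def)

text \<open>Roots of the approximating polynomials may escape to infinity or tend to the real line,
  so the coefficients are followed instead. Normalising their sum of norms to 1 bounds them and
  prevents the limit polynomial from vanishing identically.\<close>

lemma limit_of_root_loops:
  assumes f: "f \<in> loops"
    and near: "\<And>\<epsilon>. \<epsilon> > 0 \<Longrightarrow> \<exists>L. length L = n \<and> nonreal L \<and>
      (\<forall>w. norm w = 1 \<longrightarrow> dist (blaschke_list L w) (loop_coord f w) < \<epsilon>)"
  obtains M where "length M \<le> n" "nonreal M" "f = root_loop M"
proof -
  define g where "g x = loop_coord f (cayley x)" for x
  \<comment> \<open>The approximation \<open>u / cnj u\<close> of \<open>g x\<close> is stated
    without a quotient, so that it passes to the limit even where the limit polynomial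
    vanishes.\<close>
  define P where "P k c \<longleftrightarrow> (\<forall>j. norm (c j) \<le> 1) \<and> (\<Sum>j\<le>n. norm (c j)) = 1 \<and>
      (\<forall>x. norm ((\<Sum>j\<le>n. c j * of_real x ^ j) - g x * cnj (\<Sum>j\<le>n. c j * of_real x ^ j))
         \<le> norm (\<Sum>j\<le>n. c j * of_real x ^ j) / Suc k)" for k :: nat and c :: "nat \<Rightarrow> complex"
  have "\<exists>c. P k c" for k
  proof -
    obtain L where L: "length L = n" "nonreal L"
        "\<And>w. norm w = 1 \<Longrightarrow> dist (blaschke_list L w) (loop_coord f w) < 1 / Suc k"
      using near[of "1 / Suc k"] by auto
    obtain F where F: "degree F = n" "lead_coeff F = 1" "\<And>z. poly F z = root_prod L z"
      using root_poly[of L] L(1) by metis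
    define N where "N = (\<Sum>j\<le>n. norm (poly.coeff F j))"
    have "norm (poly.coeff F n) \<le> N"
      unfolding N_def by (rule member_le_sum) auto
    then have N: "N \<ge> 1" using F(1,2) by simp
    define c where "c j = poly.coeff F j / of_real N" for j
    have s: "(\<Sum>j\<le>n. c j * of_real x ^ j) = root_prod L (of_real x) / of_real N" for x
      using F(1) by (simp add: c_def poly_altdef sum_divide_distrib flip: F(3))
    have "norm (c j) \<le> 1" for j
    proof (cases "j \<le> n")
      case True
      then have "norm (poly.coeff F j) \<le> N"
        unfolding N_def by (intro member_le_sum) auto
      then show ?thesis using N by (simp add: c_def norm_divide)
    qed (use F(1) in \<open>simp add: c_def coeff_eq_0\<close>)
    moreover have "(\<Sum>j\<le>n. norm (c j)) = 1"
      using N by (simp add: c_def norm_divide flip: sum_divide_distrib N_def)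
    moreover have "norm ((\<Sum>j\<le>n. c j * of_real x ^ j) - g x * cnj (\<Sum>j\<le>n. c j * of_real x ^ j))
         \<le> norm (\<Sum>j\<le>n. c j * of_real x ^ j) / Suc k" for x
    proof -
      define u where "u = root_prod L (of_real x) / of_real N"
      have "u \<noteq> 0"
        using L(2) N by (auto simp: u_def root_prod_eq_0_iff nonreal_def)
      moreover have "phase L x = u / cnj u"
        using N by (simp add: phase_root_prod u_def)
      ultimately have "u - g x * cnj u = (phase L x - g x) * cnj u"
        by (simp add: field_simps)
      then have "norm (u - g x * cnj u) = norm (phase L x - g x) * norm u"
        by (simp add: norm_mult)
      also have "\<dots> \<le> 1 / Suc k * norm u"
        using L(3)[of "cayley x"]
        by (intro mult_right_mono) (auto simp: blaschke_list_cayley dist_norm g_def)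
      finally show ?thesis by (simp add: s u_def)
    qed
    ultimately show ?thesis unfolding P_def by blast
  qed
  then obtain c where "\<And>k. P k (c k)" by metis
  then have c: "\<And>k j. norm (c k j) \<le> 1" "\<And>k. (\<Sum>j\<le>n. norm (c k j)) = 1"
    "\<And>k x. norm ((\<Sum>j\<le>n. c k j * of_real x ^ j) - g x * cnj (\<Sum>j\<le>n. c k j * of_real x ^ j))
         \<le> norm (\<Sum>j\<le>n. c k j * of_real x ^ j) / Suc k"
    unfolding P_def by blast+
  obtain r where r: "strict_mono (r :: nat \<Rightarrow> nat)" "\<And>j. j \<in> {..n} \<Longrightarrow> \<exists>l. (\<lambda>k. c (r k) j) \<longlonglongrightarrow> l"
    using function_convergent_subsequence[of "{..n}" c 1] c(1) by auto
  then obtain l where l: "\<And>j. j \<le> n \<Longrightarrow> (\<lambda>k. c (r k) j) \<longlonglongrightarrow> l j"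
    by (metis atMost_iff)
  define F where "F = (\<Sum>j\<le>n. monom (l j) j)"
  have polyF: "poly F z = (\<Sum>j\<le>n. l j * z ^ j)" for z
    by (simp add: F_def poly_sum poly_monom)
  have lim: "(\<lambda>k. \<Sum>j\<le>n. c (r k) j * of_real x ^ j) \<longlonglongrightarrow> poly F (of_real x)" for x
    unfolding polyF by (intro tendsto_intros l) auto
  have "(\<lambda>k. \<Sum>j\<le>n. norm (c (r k) j)) \<longlonglongrightarrow> (\<Sum>j\<le>n. norm (l j))"
    by (intro tendsto_intros l) auto
  then have "(\<Sum>j\<le>n. norm (l j)) = 1"
    by (simp add: c(2) LIMSEQ_const_iff)
  moreover have "poly.coeff F j = l j" if "j \<le> n" for j
    using that by (simp add: F_def coeff_sum coeff_monom if_distrib cong: if_cong)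
  ultimately have "F \<noteq> 0"
    by (metis (no_types, lifting) atMost_iff coeff_0 norm_zero sum.neutral zero_neq_one)
  have "degree F \<le> n"
    unfolding F_def by (rule degree_sum_le) (auto intro: order.trans[OF degree_monom_le])
  have eqF: "poly F (of_real x) = g x * cnj (poly F (of_real x))" for x
  proof -
    let ?h = "\<lambda>k. \<Sum>j\<le>n. c (r k) j * of_real x ^ j"
    have "(\<lambda>k. 1 / real (Suc (r k))) \<longlonglongrightarrow> 0"
      using LIMSEQ_subseq_LIMSEQ[OF LIMSEQ_Suc[OF lim_1_over_n] r(1)] by (simp add: o_def)
    then have "(\<lambda>k. norm (?h k) * (1 / real (Suc (r k)))) \<longlonglongrightarrow> norm (poly F (of_real x)) * 0"
      by (intro tendsto_intros lim)
    moreover have "(\<lambda>k. norm (?h k - g x * cnj (?h k))) \<longlonglongrightarrow>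
        norm (poly F (of_real x) - g x * cnj (poly F (of_real x)))"
      by (intro tendsto_intros lim)
    ultimately have "norm (poly F (of_real x) - g x * cnj (poly F (of_real x))) \<le> norm (poly F (of_real x)) * 0"
      by (intro LIMSEQ_le[OF _ _]) (use c(3) in \<open>auto simp: divide_inverse\<close>)
    then show ?thesis by simp
  qed
  obtain L where L: "length L = degree F" "\<And>z. poly F z = lead_coeff F * root_prod L z"
    using complex_poly_factor_list[OF \<open>F \<noteq> 0\<close>] by blast
  define M where "M = filter (\<lambda>a. Im a \<noteq> 0) L"
  \<comment> \<open>The limit polynomial need not be monic; its leading coefficient leaves this
    constant, which the value at the point 1 later forces to be 1.\<close>
  define q where "q = lead_coeff F / cnj (lead_coeff F)"
  have "nonreal M" by (auto simp: M_def nonreal_def)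
  have gx: "g x = q * phase M x" if x: "of_real x \<notin> set L" for x
  proof -
    define u where "u = poly F (of_real x)"
    have "u \<noteq> 0"
      using x \<open>F \<noteq> 0\<close> by (simp add: u_def L(2) root_prod_eq_0_iff)
    then have "g x = u / cnj u"
      using eqF[of x] by (simp add: u_def[symmetric] nonzero_eq_divide_eq)
    also have "\<dots> = q * phase L x"
      by (simp add: u_def L(2) q_def phase_root_prod)
    finally show ?thesis
      by (simp add: M_def phase_filter_nonreal[OF x])
  qed
  have eq: "loop_coord f w = q * blaschke_list M w" if "norm w = 1" for w
  \<comment> \<open>The finite exceptional set contains infinity and the points of the real roots,
    at which the relation between \<open>F\<close> and \<open>g\<close> gives no
    information.\<close>
  proof (rule eq_on_sphere_if_cofinite[where A = "insert 1 (cayley ` Re ` set L)", OF _ _ _ _ that])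
    show "continuous_on (sphere 0 1) (loop_coord f)" by (rule continuous_on_loop_coord[OF f])
    show "continuous_on (sphere 0 1) (\<lambda>w. q * blaschke_list M w)"
      by (intro continuous_intros continuous_on_blaschke_list \<open>nonreal M\<close>)
    fix w :: complex assume w: "norm w = 1" "w \<notin> insert 1 (cayley ` Re ` set L)"
    then obtain x where x: "w = cayley x" using cayley_surj by blast
    then have "of_real x \<notin> set L" using w(2) by force
    then show "loop_coord f w = q * blaschke_list M w"
      using gx[of x] by (simp add: x g_def blaschke_list_cayley)
  qed simp
  from eq[of 1] have "q = 1"
    using loop_coord_1[OF f] by (simp add: blaschke_list_1)
  then have "f = root_loop M"
    using eq \<open>nonreal M\<close> f by (intro root_loop_eqI) auto
  moreover have "length M \<le> n"
    using L(1) \<open>degree F \<le> n\<close> length_filter_le[of _ L] by (auto simp: M_def intro: order.trans)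
  ultimately show ?thesis
    using that \<open>nonreal M\<close> by blast
qed

text \<open>The roots \<open>\<i>\<close> and \<open>- \<i>\<close> contribute inverse factors.
  Appending such pairs brings a shorter list up to length \<open>n\<close>.\<close>

lemma blaschke_list_pad:
  assumes "norm w = 1"
  shows "blaschke_list (L @ replicate k \<i> @ replicate k (- \<i>)) w = blaschke_list L w"
proof -
  have "blaschke_list (replicate k a) w = blaschke a w ^ k" for a
    by (induction k) auto
  moreover have "w \<noteq> 0" using assms by auto
  ultimately show ?thesis
    by (simp add: blaschke_list_append blaschke_i power_one_over)
qed

theorem closure_RRat: "loop_RP 1 closure_of RRat n 1 = {root_loop L | L. length L = n \<and> nonreal L}"
proof (intro equalityI subsetI)
  fix f assume "f \<in> {root_loop L | L. length L = n \<and> nonreal L}"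
  then show "f \<in> loop_RP 1 closure_of RRat n 1"
    using root_loop_in_closure by auto
next
  fix f assume "f \<in> loop_RP 1 closure_of RRat n 1"
  then have f: "f \<in> loops" and near: "\<And>\<epsilon>. \<epsilon> > 0 \<Longrightarrow> \<exists>g\<in>RRat n 1 \<inter> loops. \<forall>w. norm w = 1 \<longrightarrow>
      dist (loop_coord g w) (loop_coord f w) < \<epsilon>"
    unfolding closure_RRat_iff by blast+
  have near': "\<exists>L. length L = n \<and> nonreal L \<and>
      (\<forall>w. norm w = 1 \<longrightarrow> dist (loop_coord (root_loop L) w) (loop_coord f w) < \<epsilon>)" if "\<epsilon> > 0" for \<epsilon>
    using near[OF that] RRat_imp_root_loop by (metis IntE)
  then have "\<exists>L. length L = n \<and> nonreal L \<and>
      (\<forall>w. norm w = 1 \<longrightarrow> dist (blaschke_list L w) (loop_coord f w) < \<epsilon>)" if "\<epsilon> > 0" for \<epsilon>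
    using that root_loop(2) by metis
  then obtain M where M: "length M \<le> n" "nonreal M" "f = root_loop M"
    using limit_of_root_loops[OF f] by blast
  \<comment> \<open>One approximant within distance 1 already has the degree of the limit. Since
    length and degree have the same parity, the number of lost roots is even.\<close>
  obtain L where L: "length L = n" "nonreal L"
      "\<And>w. norm w = 1 \<Longrightarrow> dist (loop_coord (root_loop L) w) (loop_coord f w) < 1"
    using near'[of 1] by auto
  have "root_degree L = root_degree M"
    using degree_locally_constant[OF f root_loop(1)[OF L(2)] L(3)] M(3)
    by (simp add: RP1_degree_root_loop L(2) M(2))
  then have "int n - int (length M) = 2 * (int (length (upper_roots L)) - int (length (upper_roots M)))"
    using length_roots[OF L(2)] length_roots[OF M(2)] L(1) by (simp add: root_degree_def)
  then have "even (n - length M)"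
    using M(1) by (metis dvd_triv_left even_of_nat of_nat_diff)
  then obtain k where k: "n = length M + 2 * k"
    using M(1) by (metis dvdE le_add_diff_inverse)
  let ?P = "M @ replicate k \<i> @ replicate k (- \<i>)"
  have P: "nonreal ?P" using M(2) by (auto simp: nonreal_def)
  have "f = root_loop ?P"
    using root_loop(2)[OF M(2)] blaschke_list_pad M(3)
    by (intro root_loop_eqI[OF f P]) simp
  moreover have "length ?P = n" using k by simp
  ultimately show "f \<in> {root_loop L | L. length L = n \<and> nonreal L}"
    using P by blast
qed

subsection \<open>Connected components\<close>

text \<open>Off \<open>w = 1\<close> this is the estimate on the real line, with length and degree
  fixing the number of roots in each half plane; at \<open>w = 1\<close> all these functions take
  the value 1.\<close>

lemma blaschke_list_contract_nonexpansive:
  assumes L: "nonreal L" and M: "nonreal M" and len: "length L = length M"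
    and deg: "root_degree L = root_degree M" and d: "d < 2"
    and near: "\<And>w. norm w = 1 \<Longrightarrow> dist (blaschke_list M w) (blaschke_list L w) \<le> d"
    and t: "0 \<le> t" "t \<le> 1" and w: "norm w = 1"
  shows "dist (blaschke_list (map (contract_root t) M) w) (blaschke_list (map (contract_root t) L) w) \<le> d"
proof (cases "w = 1")
  case True
  have "0 \<le> d" using near[of 1] by (simp add: blaschke_list_1)
  then show ?thesis by (simp add: True blaschke_list_1)
next
  case False
  then obtain x where x: "w = cayley x" using cayley_surj[OF w] by blast
  have "length (upper_roots L) = length (upper_roots M)" "length (lower_roots L) = length (lower_roots M)"
    using deg len length_roots[OF L] length_roots[OF M] by (auto simp: root_degree_def)
  moreover have "norm (phase M x - phase L x) \<le> d" for x
    using near[of "cayley x"] by (simp add: blaschke_list_cayley dist_norm)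
  ultimately show ?thesis
    using phase_contract_nonexpansive[OF L M _ _ d _ t] by (simp add: x blaschke_list_cayley dist_norm)
qed

lemma root_degree_contract:
  assumes "0 \<le> t" "t \<le> 1" "nonreal L"
  shows "root_degree (map (contract_root t) L) = root_degree L"
  using upper_roots_contract[OF assms] by (simp add: root_degree_def)

definition rat_degree_set :: "nat \<Rightarrow> int \<Rightarrow> ((nat \<Rightarrow> real) set \<Rightarrow> (nat \<Rightarrow> real) set) set" where
  "rat_degree_set n d = {f \<in> topspace (rat_space n 1). RP1_degree f = d}"

lemma topspace_rat_space: "topspace (rat_space n 1) = {root_loop L | L. length L = n \<and> nonreal L}"
  unfolding rat_space_def closure_RRat using root_loop(1) by auto

lemma rat_degree_set_eq:
  "rat_degree_set n d = {root_loop L | L. length L = n \<and> nonreal L \<and> root_degree L = d}"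
  unfolding rat_degree_set_def topspace_rat_space using RP1_degree_root_loop by auto

lemma subtopology_rat_space:
  "subtopology (rat_space n 1) (rat_degree_set n d) = subtopology (loop_RP 1) (rat_degree_set n d)"
proof -
  have "rat_degree_set n d \<subseteq> loop_RP 1 closure_of RRat n 1"
    unfolding closure_RRat rat_degree_set_eq by blast
  then show ?thesis
    by (simp add: rat_space_def subtopology_subtopology Int_absorb1)
qed

lemma rat_degree_set_subset_loops: "rat_degree_set n d \<subseteq> loops"
  unfolding rat_degree_set_eq using root_loop(1) by blast

lemma openin_rat_degree_set: "openin (rat_space n 1) (rat_degree_set n d)"
proof -
  have "openin (loop_RP 1) {f \<in> loops. RP1_degree f = d}"
    unfolding openin_loop_RP_iff
  proof (intro conjI ballI)
    fix f assume "f \<in> {f \<in> loops. RP1_degree f = d}"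
    then have "\<forall>g\<in>loops. (\<forall>w. norm w = 1 \<longrightarrow> dist (loop_coord g w) (loop_coord f w) < 1) \<longrightarrow>
        g \<in> {f \<in> loops. RP1_degree f = d}"
      using degree_locally_constant[of f] by blast
    with zero_less_one show "\<exists>\<epsilon>>0. \<forall>g\<in>loops. (\<forall>w. norm w = 1 \<longrightarrow> dist (loop_coord g w) (loop_coord f w) < \<epsilon>) \<longrightarrow>
        g \<in> {f \<in> loops. RP1_degree f = d}"
      by blast
  qed blast
  moreover have "rat_degree_set n d = {f \<in> loops. RP1_degree f = d} \<inter> (loop_RP 1 closure_of RRat n 1)"
    by (auto simp: rat_degree_set_def rat_space_def)
  ultimately show ?thesis
    unfolding rat_space_def openin_subtopology by blast
qed

lemma contractible_rat_degree_set:
  assumes "rat_degree_set n d \<noteq> {}"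
  shows "contractible_space (subtopology (rat_space n 1) (rat_degree_set n d))"
proof -
  let ?W = "rat_degree_set n d"
  let ?X = "subtopology (loop_RP 1) ?W"
  have W: "topspace ?X = ?W"
    using rat_degree_set_subset_loops by auto
  \<comment> \<open>An arbitrary choice, possibly discontinuous in \<open>f\<close>; continuity of
    \<open>H\<close> rests on the non-expansive estimate.\<close>
  define lst where "lst f = (SOME L. length L = n \<and> nonreal L \<and> root_degree L = d \<and> f = root_loop L)" for f
  have lst: "length (lst f) = n" "nonreal (lst f)" "root_degree (lst f) = d" "root_loop (lst f) = f"
    if "f \<in> ?W" for f
  proof -
    have "\<exists>L. length L = n \<and> nonreal L \<and> root_degree L = d \<and> f = root_loop L"
      using that unfolding rat_degree_set_eq by blast
    from someI_ex[OF this]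
    show "length (lst f) = n" "nonreal (lst f)" "root_degree (lst f) = d" "root_loop (lst f) = f"
      unfolding lst_def by auto
  qed
  define H where "H = (\<lambda>(t, f). root_loop (map (contract_root t) (lst f)))"
  have nr: "nonreal (map (contract_root t) (lst f))" if "t \<in> {0..1}" "f \<in> ?W" for t f
    using that lst(2) by (intro nonreal_contract) auto
  have H_in: "H (t, f) \<in> ?W" if "t \<in> {0..1}" "f \<in> ?W" for t f
  proof -
    have "root_degree (map (contract_root t) (lst f)) = d"
      using that root_degree_contract[of t "lst f"] lst(2,3) by simp
    then show ?thesis
      unfolding rat_degree_set_eq H_def using nr[OF that] lst(1)[OF that(2)] by auto
  qed
  have coord_H: "loop_coord (H (t, f)) w = blaschke_list (map (contract_root t) (lst f)) w"
    if "t \<in> {0..1}" "f \<in> ?W" "norm w = 1" for t f w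
    using root_loop(2)[OF nr[OF that(1,2)] that(3)] by (simp add: H_def)
  have coord: "loop_coord f w = blaschke_list (lst f) w" if "f \<in> ?W" "norm w = 1" for f w
    using root_loop(2)[OF lst(2)[OF that(1)] that(2)] lst(4)[OF that(1)] by simp
  have "continuous_map (prod_topology (top_of_set {0..1}) ?X) ?X H"
    unfolding continuous_map_def
  proof (intro conjI allI impI)
    show "H \<in> topspace (prod_topology (top_of_set {0..1}) ?X) \<rightarrow> topspace ?X"
      using H_in W by auto
    fix U assume "openin ?X U"
    then obtain T where T: "openin (loop_RP 1) T" "U = T \<inter> ?W"
      by (auto simp: openin_subtopology)
    show "openin (prod_topology (top_of_set {0..1}) ?X)
        {x \<in> topspace (prod_topology (top_of_set {0..1}) ?X). H x \<in> U}"
    proof (subst openin_subopen, intro ballI)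
      fix p assume p: "p \<in> {x \<in> topspace (prod_topology (top_of_set {0..1}) ?X). H x \<in> U}"
      then obtain t0 f0 where tf0: "p = (t0, f0)" "t0 \<in> {0..1}" "f0 \<in> ?W" "H (t0, f0) \<in> T"
        using W T(2) by (cases p) auto
      obtain \<epsilon> where \<epsilon>: "\<epsilon> > 0" "\<And>g. g \<in> loops \<Longrightarrow>
          (\<And>w. norm w = 1 \<Longrightarrow> dist (loop_coord g w) (loop_coord (H (t0, f0)) w) < \<epsilon>) \<Longrightarrow> g \<in> T"
        using T(1) tf0(4) unfolding openin_loop_RP_iff by meson
      let ?L = "lst f0"
      obtain \<delta> where \<delta>: "\<delta> > 0"
        "\<And>s t w. s \<in> {0..1} \<Longrightarrow> t \<in> {0..1} \<Longrightarrow> dist s t < \<delta> \<Longrightarrow> norm w = 1 \<Longrightarrow>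
          dist (blaschke_list (map (contract_root s) ?L) w) (blaschke_list (map (contract_root t) ?L) w) < \<epsilon> / 2"
        using blaschke_list_family_uniform[of "{0..1}" ?L contract_root "\<epsilon> / 2"] \<epsilon>(1)
          continuous_contract_root Im_contract_root_nz lst(2)[OF tf0(3)]
        by (auto simp: nonreal_def)
      define A where "A = {0..1} \<inter> ball t0 \<delta>"
      \<comment> \<open>The bound \<open>\<epsilon> / 2\<close> is for the triangle inequality, the
        bound 2 is the range of the non-expansive estimate.\<close>
      define B where "B = {g \<in> loops. \<exists>r<min (\<epsilon> / 2) 2. \<forall>w. norm w = 1 \<longrightarrow>
          dist (loop_coord g w) (loop_coord f0 w) \<le> r} \<inter> ?W"
      have "openin (top_of_set {0..1}) A"
        unfolding A_def by (rule openin_open_Int) simp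
      moreover have "openin ?X B"
        unfolding B_def openin_subtopology
        using openin_loop_ball[of f0 "min (\<epsilon> / 2) 2"] tf0(3) rat_degree_set_subset_loops by blast
      ultimately have op: "openin (prod_topology (top_of_set {0..1}) ?X) (A \<times> B)"
        by (simp add: openin_prod_Times_iff)
      have p_in: "p \<in> A \<times> B"
      proof -
        have "f0 \<in> B"
          unfolding B_def using tf0(3) \<epsilon>(1) rat_degree_set_subset_loops
          by (auto intro!: exI[of _ 0])
        then show ?thesis using tf0 \<delta>(1) by (simp add: A_def)
      qed
      have HU: "H (t, f) \<in> U" if tA: "t \<in> A" and fB: "f \<in> B" for t f
      proof -
        have t: "t \<in> {0..1}" "dist t t0 < \<delta>" and f: "f \<in> ?W"
          using tA fB by (auto simp: A_def B_def dist_commute)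
        obtain r where r: "r < \<epsilon> / 2" "r < 2"
            "\<And>w. norm w = 1 \<Longrightarrow> dist (loop_coord f w) (loop_coord f0 w) \<le> r"
          using fB by (auto simp: B_def)
        \<comment> \<open>The intermediate loop has the list of \<open>f0\<close> at time
          \<open>t\<close>: first the map changes at a fixed time, then the time changes for a fixed
          list.\<close>
        have "dist (loop_coord (H (t, f)) w) (loop_coord (H (t0, f0)) w) < \<epsilon>" if w: "norm w = 1" for w
        proof -
          have "dist (blaschke_list (map (contract_root t) (lst f)) w)
              (blaschke_list (map (contract_root t) ?L) w) \<le> r"
            using t r f tf0(3) w
            by (intro blaschke_list_contract_nonexpansive) (auto simp: lst simp flip: coord)
          moreover have "dist (blaschke_list (map (contract_root t) ?L) w)
              (blaschke_list (map (contract_root t0) ?L) w) < \<epsilon> / 2"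
            by (rule \<delta>(2)[OF t(1) tf0(2) t(2) w])
          ultimately show ?thesis
            unfolding coord_H[OF t(1) f w] coord_H[OF tf0(2,3) w]
            using r(1) dist_triangle[of "blaschke_list (map (contract_root t) (lst f)) w"
                "blaschke_list (map (contract_root t0) ?L) w" "blaschke_list (map (contract_root t) ?L) w"]
            by linarith
        qed
        then have "H (t, f) \<in> T"
          using \<epsilon>(2) H_in[OF t(1) f] rat_degree_set_subset_loops by blast
        then show ?thesis using H_in[OF t(1) f] T(2) by blast
      qed
      have "A \<times> B \<subseteq> {x \<in> topspace (prod_topology (top_of_set {0..1}) ?X). H x \<in> U}"
      proof (intro subsetI CollectI conjI)
        fix x assume "x \<in> A \<times> B"
        then obtain t f where x: "x = (t, f)" "t \<in> A" "f \<in> B" by blast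
        then show "x \<in> topspace (prod_topology (top_of_set {0..1}) ?X)"
          unfolding topspace_prod_topology W by (simp add: A_def B_def)
        show "H x \<in> U"
          using HU[OF x(2,3)] x(1) by simp
      qed
      then show "\<exists>T. openin (prod_topology (top_of_set {0..1}) ?X) T \<and> p \<in> T \<and>
          T \<subseteq> {x \<in> topspace (prod_topology (top_of_set {0..1}) ?X). H x \<in> U}"
        using op p_in by (intro exI[of _ "A \<times> B"] conjI)
    qed
  qed
  moreover have "H (0, f) = f" if "f \<in> ?W" for f
    using lst(4)[OF that] by (simp add: H_def map_idI)
  moreover obtain f1 where f1: "f1 \<in> ?W" using assms by blast
  \<comment> \<open>Both loops are the power map with exponent \<open>d\<close>.\<close>
  have "H (1, f) = H (1, f1)" if f: "f \<in> ?W" for f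
  proof (rule loop_coord_inject)
    show "H (1, f) \<in> loops" "H (1, f1) \<in> loops"
      using H_in[of 1] f f1 rat_degree_set_subset_loops by auto
    fix w :: complex assume "norm w = 1"
    moreover from this have "w \<noteq> 0" by auto
    ultimately show "loop_coord (H (1, f)) w = loop_coord (H (1, f1)) w"
      using f f1 by (simp add: coord_H blaschke_list_contract_1 lst)
  qed
  ultimately have "homotopic_with (\<lambda>_. True) ?X ?X id (\<lambda>_. H (1, f1))"
    unfolding homotopic_with[of ?X "\<lambda>_. True", simplified] W
    by (intro exI[of _ H]) simp
  then show ?thesis
    unfolding subtopology_rat_space contractible_space_def by blast
qed

lemma rat_degree_set_nonempty_iff:
  "rat_degree_set n d \<noteq> {} \<longleftrightarrow> - int n \<le> d \<and> d \<le> int n \<and> (even d \<longleftrightarrow> even n)"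
proof
  assume "rat_degree_set n d \<noteq> {}"
  then obtain L where L: "length L = n" "nonreal L" "root_degree L = d"
    unfolding rat_degree_set_eq by blast
  define u v where "u = length (upper_roots L)" and "v = length (lower_roots L)"
  have "n = v + u" "d = int v - int u"
    using length_roots[OF L(2)] L by (simp_all add: root_degree_def u_def v_def)
  then show "- int n \<le> d \<and> d \<le> int n \<and> (even d \<longleftrightarrow> even n)"
    by simp
next
  assume d: "- int n \<le> d \<and> d \<le> int n \<and> (even d \<longleftrightarrow> even n)"
  then have "even (int n - d)" "even (int n + d)" by auto
  \<comment> \<open>The numbers of roots to be placed at \<open>\<i>\<close> and at
    \<open>- \<i>\<close>: their sum is \<open>n\<close> and \<open>b - a\<close> is the
    degree.\<close>
  then obtain a b where ab: "int n - d = 2 * a" "int n + d = 2 * b" by (elim evenE)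
  define p q where "p = nat a" and "q = nat b"
  have pq: "p + q = n" "int q - int p = d"
    using ab d by (auto simp: p_def q_def)
  let ?L = "replicate p \<i> @ replicate q (- \<i>)"
  have "length ?L = n" "nonreal ?L" "root_degree ?L = d"
    using pq by (auto simp: nonreal_def root_degree_def lower_roots_def upper_roots_def)
  then show "rat_degree_set n d \<noteq> {}"
    unfolding rat_degree_set_eq by blast
qed

text \<open>A degree class is open, its complement is the union of the other open classes, and it is
  connected because it is contractible. A connected set that meets it cannot leave it.\<close>

lemma connected_component_of_rat_space:
  assumes f: "f \<in> topspace (rat_space n 1)"
  shows "connected_component_of_set (rat_space n 1) f = rat_degree_set n (RP1_degree f)"
proof
  let ?X = "rat_space n 1" and ?W = "rat_degree_set n (RP1_degree f)"
  have fW: "f \<in> ?W" using f by (simp add: rat_degree_set_def)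
  have "?W \<subseteq> topspace ?X" by (auto simp: rat_degree_set_def)
  moreover have "connected_space (subtopology ?X ?W)"
    using contractible_rat_degree_set fW contractible_imp_path_connected_space
      path_connected_imp_connected_space by blast
  ultimately have "connectedin ?X ?W"
    by (simp add: connectedin_def)
  then show "?W \<subseteq> connected_component_of_set ?X f"
    using fW by (intro connected_component_of_maximal)
  have "topspace ?X - ?W = (\<Union>d\<in>- {RP1_degree f}. rat_degree_set n d)"
    by (auto simp: rat_degree_set_def)
  then have "closedin ?X ?W"
    using \<open>?W \<subseteq> topspace ?X\<close> openin_rat_degree_set by (auto simp: closedin_def)
  then have "connected_component_of_set ?X f \<subseteq> ?W \<or> disjnt (connected_component_of_set ?X f) ?W"
    using connectedin_clopen_cases[OF connectedin_connected_component_of _ openin_rat_degree_set] by blast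
  moreover have "f \<in> connected_component_of_set ?X f"
    using f by (simp add: connected_component_of_refl)
  ultimately show "connected_component_of_set ?X f \<subseteq> ?W"
    using fW by (auto simp: disjnt_iff)
qed

theorem theorem1p3:
  fixes n :: nat
  shows "card (connected_components_of (rat_space n 1)) = n + 1 \<and>
    (\<forall>C \<in> connected_components_of (rat_space n 1).
       contractible_space (subtopology (rat_space n 1) C)) \<and>
    bij_betw (\<lambda>d. {f \<in> topspace (rat_space n 1). RP1_degree f = d})
      {d :: int. - int n \<le> d \<and> d \<le> int n \<and> (even d \<longleftrightarrow> even n)}
      (connected_components_of (rat_space n 1))"
proof -
  let ?D = "{d :: int. - int n \<le> d \<and> d \<le> int n \<and> (even d \<longleftrightarrow> even n)}"
  have D: "?D = {d. rat_degree_set n d \<noteq> {}}"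
    by (simp add: rat_degree_set_nonempty_iff)
  have "connected_components_of (rat_space n 1)
      = (\<lambda>f. rat_degree_set n (RP1_degree f)) ` topspace (rat_space n 1)"
    unfolding connected_components_of_def using connected_component_of_rat_space by (intro image_cong) auto
  also have "\<dots> = rat_degree_set n ` ?D"
    unfolding D by (auto simp: rat_degree_set_def)
  finally have comp: "connected_components_of (rat_space n 1) = rat_degree_set n ` ?D" .
  have "inj_on (rat_degree_set n) ?D"
    unfolding D by (rule inj_onI) (auto simp: rat_degree_set_def)
  then have bij: "bij_betw (rat_degree_set n) ?D (connected_components_of (rat_space n 1))"
    by (simp add: bij_betw_def comp)
  \<comment> \<open>Here \<open>k\<close> counts the roots in the lower half plane, so
    \<open>n - k\<close> lie in the upper one and the degree is \<open>2 * k - n\<close>.\<close>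
  have "?D = (\<lambda>k. 2 * int k - int n) ` {..n}"
  proof (intro equalityI subsetI)
    fix d assume d: "d \<in> ?D"
    then have "even (d + int n)" by auto
    then have "d = 2 * int (nat ((d + int n) div 2)) - int n" "nat ((d + int n) div 2) \<le> n"
      using d by (auto elim!: evenE)
    then show "d \<in> (\<lambda>k. 2 * int k - int n) ` {..n}" by blast
  qed auto
  moreover have "inj_on (\<lambda>k. 2 * int k - int n) {..n}"
    by (rule inj_onI) simp
  ultimately have "card ?D = n + 1"
    by (simp add: card_image)
  then show ?thesis
    using bij bij_betw_same_card[OF bij] contractible_rat_degree_set
    by (auto simp: comp D rat_degree_set_def [abs_def] simp del: mem_Collect_eq)
qed

end
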